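(* Let $N$ be a free $\mathbf Z$-module of finite rank with basis $(\lambda_i)_{i\in I}$, $\Lambda\subset N_{\mathbf R}$ the cone generated by this basis, $M\subset N$ a subgroup such that $\Gamma=N/M$ is torsion-free, and $j:N\to\Gamma$ the quotient map. Let $a:\Lambda\cap N\to\mathbf C$ and $\varepsilon>0$ be such that the series defining $\mathcal L_{N,\Lambda,a}(q^{-s})$ converges absolutely for all $s\in\mathcal T(\Lambda^\vee_{>-\varepsilon})$. For $s\in\mathcal T(\Lambda^\vee_{>0})$ put $$f_1(s)=\int_{\Gamma^\vee_{\mathbf U}}\mathcal L_{N,\Lambda,a}\bigl(j^\vee_{\mathbf U}(z)\,q^{-s}\bigr)\,\mathcal L_{N,\Lambda}\bigl(j^\vee_{\mathbf U}(z)\,q^{-s}\bigr)\,dz .$$ Assume $\Gamma^\vee\cap\Lambda^\vee=\{0\}$. Then the function $$s\longmapsto f_1(s)-\mathcal L_{N,\Lambda,a}(1)\,\mathcal L_{N,\Lambda\cap M_{\mathbf R}}(q^{-s})$$ is admissible of multiplicity at least $1-\mathrm{rk}(M)$.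
   Context: $q$ is the cardinality of a fixed finite field. For a $\mathbf Z$-module $N$ write $N^\vee=\mathrm{Hom}(N,\mathbf Z)$, $N_A=N\otimes A$. $(\lambda_i^\vee)$ is the basis dual to $(\lambda_i)$; $\Lambda^\vee\subset N^\vee_{\mathbf R}$ is the dual cone of $\Lambda$; for real $\eta$, $\Lambda^\vee_{>\eta}=\sum_{i\in I}\mathbf R_{>\eta}\lambda_i^\vee$; for $U\subset N^\vee_{\mathbf R}$, $\mathcal T(U)=\{s\in N^\vee_{\mathbf C}:\Re(s)\in U\}$. $\mathbf U$ is the group of complex numbers of modulus $1$; $N^\vee_{\mathbf U}=\mathrm{Hom}(N,\mathbf U)$, $N^\vee_{\mathbf C^\times}=\mathrm{Hom}(N,\mathbf C^\times)$, with pairing $\langle z,y\rangle=z(y)$. For $s\in N^\vee_{\mathbf C}$, $q^{-s}\in N^\vee_{\mathbf C^\times}$ is $y\mapsto q^{-\langle y,s\rangle}$. For $A\subset N_{\mathbf R}$ and $a:A\cap N\to\mathbf C$, $\mathcal L_{N,A,a}(z)=\sum_{y\in A\cap N}a_y\langle z,y\rangle$ for those $z\in N^\vee_{\mathbf C^\times}$ for which this converges absolutely; $\mathcal L_{N,A}$ is the case $a\equiv1$. For a subgroup $N'\subset N$, $\mathcal L_{N',A}(z)=\sum_{y\in A\cap N'}\langle z,y\rangle$. Thus $\mathcal L_{N,\Lambda,a}(1)=\sum_{y\in\Lambda\cap N}a_y$. $j^\vee:\Gamma^\vee\hookrightarrow N^\vee$ is dual to $j$ (through it $\Gamma^\vee$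 is viewed inside $N^\vee$); $j^\vee_{\mathbf U}:\Gamma^\vee_{\mathbf U}\to N^\vee_{\mathbf U}$ is the induced map; $dz$ is the Haar measure of total mass $1$ on $\Gamma^\vee_{\mathbf U}$. Admissible functions. An elementary admissible function of multiplicity at least $0$ is a function $s\mapsto\mathcal L_{N,\Lambda,b}(q^{-s})$ where $b:\Lambda\cap N\to\mathbf C$ is such that for some $\eta>0$ the series converges absolutely for all $s\in\mathcal T(\Lambda^\vee_{>-\eta})$. For an integer $r\ge1$, an elementary admissible function of multiplicity at least $-r$ is a holomorphic function $f$ on $\mathcal T(\Lambda^\vee_{>0})$ that can be written $f(s)=g(s)\,\mathcal L_{N',\mathrm{relint}(\Upsilon)}(q^{-s})$ with $\Upsilon\subset\Lambda$ a (rational polyhedral) cone of dimension at most $r$, $\mathrm{relint}(\Upsilon)$ its relative interior, $N'$ a subgroup of $N$, and $g$ elementary admissible of multiplicity at least $0$. For $r\ge0$, a function admissible of multiplicity at least $-r$ is a finite sum of elementary admissible functions of multiplicity at least $-r$. *)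

theory Defs
  imports "HOL-Analysis.Analysis" "HOL-Algebra.Elementary_Groups" "HOL-Algebra.Ring"
begin

text \<open>
  The free module \<open>N\<close> with its basis \<open>(\<lambda>\<^sub>i)\<close> is \<open>int ^ 'i\<close> with the standard basis, so \<open>N\<^sub>R\<close> is
  \<open>real ^ 'i\<close>.  The real and complex duals of \<open>N\<close> are \<open>real ^ 'i\<close> and \<open>complex ^ 'i\<close>, in the
  coordinates of the dual basis.  Elements of \<open>Hom(N, C\<^sup>\<times>)\<close> are functions \<open>int ^ 'i \<Rightarrow> complex\<close>.
\<close>

definition lattice_group :: "(int ^ 'i) monoid" where
  "lattice_group = \<lparr>carrier = UNIV, monoid.mult = (+), one = 0\<rparr>"

definition emb :: "int ^ 'i \<Rightarrow> real ^ 'i" where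
  "emb y = (\<chi> i. real_of_int (y $ i))"

definition pairing :: "int ^ 'i \<Rightarrow> complex ^ 'i \<Rightarrow> complex" where
  "pairing y s = (\<Sum>i\<in>UNIV. of_int (y $ i) * s $ i)"

definition q_pow :: "nat \<Rightarrow> complex ^ 'i \<Rightarrow> int ^ 'i \<Rightarrow> complex" where
  "q_pow q s = (\<lambda>y. of_nat q powr (- pairing y s))"

definition Lambda :: "(real ^ 'i) set" where
  "Lambda = convex_cone hull (range (\<lambda>i. emb (axis i 1)))"

text \<open>The inner product of \<open>real ^ 'i\<close> plays the role of the pairing of \<open>N\<^sub>R\<close> with its dual.\<close>

definition dual_cone :: "(real ^ 'i) set \<Rightarrow> (real ^ 'i) set" where
  "dual_cone C = {t. \<forall>v\<in>C. 0 \<le> v \<bullet> t}"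

definition Lambda_dual_gt :: "real \<Rightarrow> (real ^ 'i) set" where
  "Lambda_dual_gt \<eta> = {\<Sum>i\<in>UNIV. c i *\<^sub>R axis i 1 | c. \<forall>i. c i > \<eta>}"

definition tube :: "(real ^ 'i) set \<Rightarrow> (complex ^ 'i) set" where
  "tube U = {s. (\<chi> i. Re (s $ i)) \<in> U}"

definition real_span :: "(int ^ 'i) set \<Rightarrow> (real ^ 'i) set" where
  "real_span M = span (emb ` M)"

text \<open>A subgroup \<open>M\<close> of \<open>N\<close> is free, and its rank is the dimension of \<open>M\<^sub>R\<close>.\<close>

definition rk :: "(int ^ 'i) set \<Rightarrow> nat" where
  "rk M = dim (real_span M)"

definition torsion_free :: "('g, 'm) monoid_scheme \<Rightarrow> bool" where
  "torsion_free G \<longleftrightarrow>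
     (\<forall>x\<in>carrier G. \<forall>n::nat. n > 0 \<longrightarrow> x [^]\<^bsub>G\<^esub> n = \<one>\<^bsub>G\<^esub> \<longrightarrow> x = \<one>\<^bsub>G\<^esub>)"

definition quot_map :: "(int ^ 'i) set \<Rightarrow> int ^ 'i \<Rightarrow> (int ^ 'i) set" where
  "quot_map M y = M #>\<^bsub>lattice_group\<^esub> y"

text \<open>The dual \<open>Hom(N/M, Z)\<close>, embedded in the real dual of \<open>N\<close> by composition with \<open>N \<rightarrow> N/M\<close>.\<close>

definition Gamma_dual :: "(int ^ 'i) set \<Rightarrow> (real ^ 'i) set" where
  "Gamma_dual M =
     {t. \<exists>\<phi> \<in> hom (lattice_group Mod M) integer_group.
           \<forall>y. emb y \<bullet> t = real_of_int (\<phi> (quot_map M y))}"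

definition circle_group :: "complex monoid" where
  "circle_group = \<lparr>carrier = sphere 0 1, monoid.mult = (*), one = 1\<rparr>"

text \<open>
  Homomorphisms are normalised outside the carrier, so that distinct elements of \<open>dual_U G\<close> differ
  on \<open>carrier G\<close>; its topology is that of pointwise convergence, induced from the function space.
\<close>

definition dual_U :: "('g, 'm) monoid_scheme \<Rightarrow> ('g \<Rightarrow> complex) set" where
  "dual_U G = hom G circle_group \<inter> extensional (carrier G)"

text \<open>
  Translation-invariant Borel probability measures on the compact group \<open>dual_U G\<close>; there is exactly
  one, the Haar measure of total mass 1.
\<close>

definition haar_prob :: "('g, 'm) monoid_scheme \<Rightarrow> ('g \<Rightarrow> complex) measure \<Rightarrow> bool" where
  "haar_prob G \<mu> \<longleftrightarrow>
     sets \<mu> = sets (restrict_space borel (dual_U G)) \<and>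
     emeasure \<mu> (space \<mu>) = 1 \<and>
     (\<forall>w\<in>dual_U G. \<forall>A\<in>sets \<mu>.
        emeasure \<mu> ((\<lambda>z. \<lambda>x\<in>carrier G. w x * z x) ` A) = emeasure \<mu> A)"

definition j_dual :: "(int ^ 'i) set \<Rightarrow> ((int ^ 'i) set \<Rightarrow> complex) \<Rightarrow> int ^ 'i \<Rightarrow> complex" where
  "j_dual M z = z \<circ> quot_map M"

definition L_conv ::
  "(int ^ 'i) set \<Rightarrow> (real ^ 'i) set \<Rightarrow> (int ^ 'i \<Rightarrow> complex) \<Rightarrow> (int ^ 'i \<Rightarrow> complex) \<Rightarrow> bool" where
  "L_conv N' A a z \<longleftrightarrow> (\<lambda>y. norm (a y * z y)) summable_on {y\<in>N'. emb y \<in> A}"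

definition L_fun ::
  "(int ^ 'i) set \<Rightarrow> (real ^ 'i) set \<Rightarrow> (int ^ 'i \<Rightarrow> complex) \<Rightarrow> (int ^ 'i \<Rightarrow> complex) \<Rightarrow> complex" where
  "L_fun N' A a z = (\<Sum>\<^sub>\<infinity>y\<in>{y\<in>N'. emb y \<in> A}. a y * z y)"

text \<open>Holomorphy in several variables: Frechet differentiability with complex-linear derivative.\<close>

definition holomorphic_Cn :: "(complex ^ 'i \<Rightarrow> complex) \<Rightarrow> (complex ^ 'i) set \<Rightarrow> bool" where
  "holomorphic_Cn f S \<longleftrightarrow> open S \<and>
     (\<forall>s\<in>S. \<exists>D. (f has_derivative D) (at s) \<and> (\<forall>c v. D (c *s v) = c * D v))"

definition rational_cone :: "(real ^ 'i) set \<Rightarrow> bool" where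
  "rational_cone C \<longleftrightarrow> (\<exists>V. finite V \<and> C = convex_cone hull (emb ` V))"

text \<open>
  All admissible functions are regarded as functions on \<open>tube (Lambda_dual_gt 0)\<close>; their values
  elsewhere are irrelevant.
\<close>

definition elem_admissible_0 :: "nat \<Rightarrow> (complex ^ 'i \<Rightarrow> complex) \<Rightarrow> bool" where
  "elem_admissible_0 q f \<longleftrightarrow>
     (\<exists>b. (\<exists>\<eta>>0. \<forall>s\<in>tube (Lambda_dual_gt (- \<eta>)). L_conv UNIV Lambda b (q_pow q s)) \<and>
          (\<forall>s\<in>tube (Lambda_dual_gt 0). f s = L_fun UNIV Lambda b (q_pow q s)))"

definition elem_admissible :: "nat \<Rightarrow> nat \<Rightarrow> (complex ^ 'i \<Rightarrow> complex) \<Rightarrow> bool" where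
  "elem_admissible q r f \<longleftrightarrow>
     (if r = 0 then elem_admissible_0 q f
      else holomorphic_Cn f (tube (Lambda_dual_gt 0)) \<and>
        (\<exists>g \<Upsilon> N'. elem_admissible_0 q g \<and>
           rational_cone \<Upsilon> \<and> \<Upsilon> \<subseteq> Lambda \<and> dim \<Upsilon> \<le> r \<and>
           subgroup N' lattice_group \<and>
           (\<forall>s\<in>tube (Lambda_dual_gt 0).
              f s = g s * L_fun N' (rel_interior \<Upsilon>) (\<lambda>_. 1) (q_pow q s))))"

text \<open>Admissible of multiplicity at least \<open>m\<close>; the notion only exists for \<open>m = - r \<le> 0\<close>.\<close>

definition admissible :: "nat \<Rightarrow> int \<Rightarrow> (complex ^ 'i \<Rightarrow> complex) \<Rightarrow> bool" where
  "admissible q m f \<longleftrightarrow> m \<le> 0 \<and>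
     (\<exists>(n::nat) F. (\<forall>k<n. elem_admissible q (nat (- m)) (F k)) \<and>
        (\<forall>s\<in>tube (Lambda_dual_gt 0). f s = (\<Sum>k<n. F k s)))"

definition f1 ::
  "nat \<Rightarrow> (int ^ 'i) set \<Rightarrow> ((int ^ 'i) set \<Rightarrow> complex) measure \<Rightarrow> (int ^ 'i \<Rightarrow> complex) \<Rightarrow>
   complex ^ 'i \<Rightarrow> complex" where
  "f1 q M \<mu> a s =
     (\<integral>z. L_fun UNIV Lambda a (\<lambda>y. j_dual M z y * q_pow q s y) *
          L_fun UNIV Lambda (\<lambda>_. 1) (\<lambda>y. j_dual M z y * q_pow q s y) \<partial>\<mu>)"

end

theory Submission
  imports Defs "HOL-Analysis.Kronecker_Approximation_Theorem"
    "HOL-Computational_Algebra.Primes" "HOL-Probability.Probability_Measure"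
begin

text \<open>
  Write \<open>z\<^sup>y\<close> for \<open>q_pow q s y\<close> and \<open>x \<le> m\<close> for the coordinatewise order on the lattice.
  Expanding both series under the integral and integrating term by term, only the pairs whose sum
  lies in \<open>M\<close> survive, because the characters of a torsion-free quotient separate its points
  (\<open>f1_eq_sum\<close>).  With \<open>m\<close> for the sum of the pair, \<open>f\<^sub>1(s)\<close> is the sum of \<open>a\<^sub>x z\<^sup>m\<close> over \<open>0 \<le> x \<le> m\<close>,
  \<open>m \<in> M\<close>.  The subtracted product is the same sum over all nonnegative \<open>x\<close> and \<open>m\<close>, so the
  difference is minus the sum of \<open>a\<^sub>x z\<^sup>m\<close> over the pairs with \<open>x \<le> m\<close> false.

  Such an \<open>m\<close> has a coordinate that is small compared to \<open>x\<close>, while \<open>a\<^sub>x\<close> decays exponentially in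
  \<open>x\<close>; so a whole direction in \<open>M\<close> is lost, which is what lowers the multiplicity from the rank of
  \<open>M\<close> to the rank minus one.  Two facts make this precise.

  \<^item> The hypothesis on the dual lattice means that \<open>M\<close> contains a vector with all coordinates positive
    (\<open>positive_element\<close>): otherwise a separating hyperplane gives a nonnegative real functional that
    vanishes on \<open>M\<close>, and simultaneous Diophantine approximation turns it into an integral one.

  \<^item> The monoid of nonnegative elements of \<open>M\<close> has a finite set \<open>V\<close> of generators, and each element has a
    normal form as a combination of generators such that the normal forms are a down-set and are
    eventually stable under increasing a large coefficient (\<open>normal_forms\<close>).  This does the work of a
    triangulation of the cone.

  Cut every coefficient of the normal form of \<open>m\<close> at a bound \<open>K\<^sub>x\<close> that grows linearly in \<open>x\<close>.  The
  set \<open>J\<close> of generators whose coefficient exceeds the bound splits the sum into finitely many parts.  In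
  each part the truncated combination and the excess vary independently, so that the part is a product of
  a series in the pairs of \<open>x\<close> and a truncated combination, which converges slightly beyond the tube
  thanks to the decay of \<open>a\<^sub>x\<close>, and of the lattice series of the relative interior of the cone over
  \<open>J\<close>.  Uniqueness of normal forms makes \<open>J\<close> linearly independent, and \<open>J\<close> has fewer elements than
  the rank of \<open>M\<close>: a basis of \<open>M\<^sub>R\<close> meets every coordinate, and large coefficients on it would
  force \<open>x \<le> m\<close> (\<open>deficient_series_admissible\<close>).
\<close>

section \<open>Coordinates and finitely generated cones\<close>

lemma emb_nth [simp]: "emb y $ i = real_of_int (y $ i)"
  by (simp add: emb_def)

lemma emb_0 [simp]: "emb 0 = 0"
  and emb_add: "emb (x + y) = emb x + emb y"
  and emb_diff: "emb (x - y) = emb x - emb y"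
  and emb_scale: "emb (c *s y) = of_int c *\<^sub>R emb y"
  by (simp_all add: vec_eq_iff)

lemma emb_eq_iff [simp]: "emb x = emb y \<longleftrightarrow> x = y"
  by (simp add: vec_eq_iff)

lemma inj_emb: "inj emb"
  by (simp add: inj_def)

lemma emb_sum: "emb (sum f A) = (\<Sum>x\<in>A. emb (f x))"
  by (induction A rule: infinite_finite_induct) (simp_all add: emb_add)

lemma convex_cone_sum_mem:
  assumes "convex_cone C" "finite V" "\<And>v. v \<in> V \<Longrightarrow> 0 \<le> c v" "V \<subseteq> C"
  shows "(\<Sum>v\<in>V. c v *\<^sub>R v) \<in> C"
  using assms(2,3,4)
proof (induction V)
  case empty
  then show ?case using assms(1) by (simp add: convex_cone_contains_0)
next
  case (insert v V)
  have "c v *\<^sub>R v \<in> C"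
    using assms(1) insert.prems by (simp add: conic_def convex_cone_def)
  with insert show ?case
    by (simp add: convex_cone_add[OF assms(1)])
qed

lemma convex_cone_hull_finite:
  assumes "finite V"
  shows "convex_cone hull V = {\<Sum>v\<in>V. c v *\<^sub>R v | c. \<forall>v\<in>V. 0 \<le> c v}" (is "_ = ?R")
proof
  have "v \<in> ?R" if "v \<in> V" for v
    using that assms
    by (intro CollectI exI[of _ "\<lambda>w. if w = v then 1 else 0"])
       (simp add: if_distrib[of "\<lambda>c. c *\<^sub>R _"] cong: if_cong)
  moreover have "convex_cone ?R"
    unfolding convex_cone_iff
  proof (intro conjI ballI allI impI)
    show "0 \<in> ?R"
      by (intro CollectI exI[of _ "\<lambda>_. 0"]) simp
    fix x y assume "x \<in> ?R" "y \<in> ?R"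
    then obtain c d where "x = (\<Sum>v\<in>V. c v *\<^sub>R v)" "\<forall>v\<in>V. 0 \<le> c v"
      "y = (\<Sum>v\<in>V. d v *\<^sub>R v)" "\<forall>v\<in>V. 0 \<le> d v"
      by blast
    then show "x + y \<in> ?R"
      by (intro CollectI exI[of _ "\<lambda>v. c v + d v"]) (simp add: scaleR_add_left sum.distrib)
  next
    fix x and t :: real assume "x \<in> ?R" "0 \<le> t"
    then obtain c where "x = (\<Sum>v\<in>V. c v *\<^sub>R v)" "\<forall>v\<in>V. 0 \<le> c v"
      by blast
    then show "t *\<^sub>R x \<in> ?R" using \<open>0 \<le> t\<close>
      by (intro CollectI exI[of _ "\<lambda>v. t * c v"]) (simp add: scaleR_sum_right)
  qed
  ultimately show "convex_cone hull V \<subseteq> ?R"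
    by (intro hull_minimal) auto
  show "?R \<subseteq> convex_cone hull V"
    using convex_cone_sum_mem[OF convex_cone_convex_cone_hull assms] hull_subset[of V convex_cone]
    by blast
qed

lemma Lambda_eq: "Lambda = {v::real^'i. \<forall>i. 0 \<le> v $ i}"
proof
  show "Lambda \<subseteq> {v::real^'i. \<forall>i. 0 \<le> v $ i}"
    unfolding Lambda_def
  proof (rule hull_minimal)
    show "range (\<lambda>i. emb (axis i 1)) \<subseteq> {v::real^'i. \<forall>i. 0 \<le> v $ i}"
      by (auto simp: axis_def)
    show "convex_cone {v::real^'i. \<forall>i. 0 \<le> v $ i}"
      unfolding convex_cone_iff by (auto intro: exI[of _ 0])
  qed
  show "{v::real^'i. \<forall>i. 0 \<le> v $ i} \<subseteq> Lambda"
  proof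
    fix v :: "real^'i" assume v: "v \<in> {v. \<forall>i. 0 \<le> v $ i}"
    have inj: "inj (\<lambda>i::'i. emb (axis i 1))"
      by (auto simp: inj_def axis_eq_axis)
    have "(\<Sum>w\<in>range (\<lambda>i::'i. emb (axis i 1)). (v \<bullet> w) *\<^sub>R w) \<in> Lambda"
      unfolding Lambda_def using v
      by (intro convex_cone_sum_mem convex_cone_convex_cone_hull hull_subset)
         (auto simp: inner_vec_def axis_def intro!: sum_nonneg)
    moreover have "(\<Sum>w\<in>range (\<lambda>i::'i. emb (axis i 1)). (v \<bullet> w) *\<^sub>R w) = v"
      by (subst sum.reindex[OF inj])
         (simp add: vec_eq_iff inner_vec_def axis_def if_distrib sum.delta cong: if_cong)
    ultimately show "v \<in> Lambda" by simp
  qed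
qed

text \<open>
  The cone is the Minkowski sum of the rays through its generators, and relative interiors commute
  with Minkowski sums of convex sets.
\<close>

lemma rel_interior_convex_cone_hull_finite:
  fixes V :: "'a::euclidean_space set"
  assumes "finite V"
  shows "rel_interior (convex_cone hull V) = {\<Sum>v\<in>V. c v *\<^sub>R v | c. \<forall>v\<in>V. 0 < c v}"
proof -
  have ray: "rel_interior ((\<lambda>c. c *\<^sub>R v) ` {0..}) = (\<lambda>c. c *\<^sub>R v) ` {0<..}" for v :: 'a
  proof -
    have "rel_interior {0::real..} = {0<..}"
      by (subst rel_interior_nonempty_interior) auto
    then show ?thesis
      by (metis bounded_linear_scaleR_left bounded_linear.linear convex_real_interval(1)
          rel_interior_convex_linear_image)
  qed
  have choice: "{sum s V |s. \<forall>v\<in>V. s v \<in> (\<lambda>c. c *\<^sub>R v) ` T} =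
      {\<Sum>v\<in>V. c v *\<^sub>R v | c. \<forall>v\<in>V. c v \<in> T}" (is "?L = ?R") for T :: "real set"
  proof
    show "?L \<subseteq> ?R"
    proof clarify
      fix s assume "\<forall>v\<in>V. s v \<in> (\<lambda>c. c *\<^sub>R v) ` T"
      then have "\<forall>v\<in>V. \<exists>c. s v = c *\<^sub>R v \<and> c \<in> T"
        by blast
      then obtain c where "\<forall>v\<in>V. s v = c v *\<^sub>R v \<and> c v \<in> T"
        unfolding bchoice_iff by blast
      then show "\<exists>c. sum s V = (\<Sum>v\<in>V. c v *\<^sub>R v) \<and> (\<forall>v\<in>V. c v \<in> T)"
        by (intro exI[of _ c]) simp
    qed
    show "?R \<subseteq> ?L"
      by blast
  qed
  have "convex_cone hull V = sum (\<lambda>v. (\<lambda>c. c *\<^sub>R v) ` {0..}) V"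
    unfolding set_sum_alt[OF assms] choice convex_cone_hull_finite[OF assms] by simp
  then have "rel_interior (convex_cone hull V) = sum (\<lambda>v. rel_interior ((\<lambda>c. c *\<^sub>R v) ` {0..})) V"
    by (simp add: rel_interior_sum_gen convex_linear_image linear_iff scaleR_add_left)
  then show ?thesis
    unfolding ray set_sum_alt[OF assms] choice by simp
qed

text \<open>
  The only bridge between real and integral linear algebra in this development: after multiplication by a
  common integer, real coefficients are so close to integers that an integral linear combination is known up
  to an error below \<open>\<delta>\<close>.  For \<open>\<delta> \<le> 1\<close>, an integral combination within \<open>\<delta>\<close> of an
  integer equals it.
\<close>

lemma Dirichlet_approx_matrix:
  fixes c :: "'b \<Rightarrow> real" and A :: "'b \<Rightarrow> 'c \<Rightarrow> int"
  assumes "finite J" "finite I" "0 < \<delta>"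
  shows "\<exists>N p. 0 < (N::int) \<and> (\<forall>j\<in>J. \<bar>of_int N * c j - of_int (p j)\<bar> < \<delta>) \<and>
    (\<forall>i\<in>I. \<bar>of_int N * (\<Sum>j\<in>J. c j * of_int (A j i)) - of_int (\<Sum>j\<in>J. p j * A j i)\<bar> < \<delta>)"
proof -
  define B where "B = 1 + (\<Sum>i\<in>I. \<Sum>j\<in>J. \<bar>real_of_int (A j i)\<bar>)"
  have B1: "1 \<le> B" by (simp add: B_def sum_nonneg)
  obtain n :: nat where n: "B / \<delta> < real n"
    using reals_Archimedean2 by blast
  have n0: "0 < n"
    using n B1 assms(3) by (metis divide_pos_pos gr0I less_eq_real_def less_le_trans not_less of_nat_0 order_less_irrefl zero_less_one less_trans)
  have nB: "B < \<delta> * n"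
    using n assms(3) by (simp add: field_simps)
  obtain h where h: "bij_betw h {..<card J} J"
    using assms(1) by (metis ex_bij_betw_nat_finite lessThan_atLeast0)
  obtain N p where N: "0 < N" and p: "\<And>k. k < card J \<Longrightarrow> \<bar>of_int N * c (h k) - of_int (p k)\<bar> < 1 / n"
    using Dirichlet_approx_simult[OF n0, of "card J" "c \<circ> h"] by (metis comp_apply)
  define p' where "p' j = p (inv_into {..<card J} h j)" for j
  have p': "\<bar>of_int N * c j - of_int (p' j)\<bar> < 1 / n" if "j \<in> J" for j
    using p[of "inv_into {..<card J} h j"] that h unfolding p'_def
    by (metis bij_betw_imp_surj_on bij_betw_inv_into_right inv_into_into lessThan_iff)
  have n\<delta>: "1 / n < \<delta>"
    using nB B1 n0 by (simp add: field_simps)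
  show ?thesis
  proof (intro exI[of _ N] exI[of _ p'] conjI ballI)
    show "0 < N" by fact
    show "\<bar>of_int N * c j - of_int (p' j)\<bar> < \<delta>" if "j \<in> J" for j
      using p'[OF that] n\<delta> by linarith
  next
    fix i assume i: "i \<in> I"
    have "\<bar>of_int N * (\<Sum>j\<in>J. c j * of_int (A j i)) - of_int (\<Sum>j\<in>J. p' j * A j i)\<bar>
        = \<bar>\<Sum>j\<in>J. (of_int N * c j - of_int (p' j)) * of_int (A j i)\<bar>"
      by (simp add: sum_distrib_left sum_subtractf algebra_simps)
    also have "\<dots> \<le> (\<Sum>j\<in>J. \<bar>(of_int N * c j - of_int (p' j)) * of_int (A j i)\<bar>)"
      by (rule sum_abs)
    also have "\<dots> \<le> (\<Sum>j\<in>J. 1 / n * \<bar>of_int (A j i)\<bar>)"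
      unfolding abs_mult by (intro sum_mono mult_right_mono) (use p' in \<open>auto intro: less_imp_le\<close>)
    also have "\<dots> \<le> 1 / n * (\<Sum>i\<in>I. \<Sum>j\<in>J. \<bar>real_of_int (A j i)\<bar>)"
      unfolding sum_distrib_left[symmetric] 
      by (intro mult_left_mono member_le_sum[OF i]) (auto simp: sum_nonneg assms)
    also have "\<dots> < \<delta>"
      using nB n0 by (simp add: B_def field_simps)
    finally show "\<bar>of_int N * (\<Sum>j\<in>J. c j * of_int (A j i)) - of_int (\<Sum>j\<in>J. p' j * A j i)\<bar> < \<delta>" .
  qed
qed

section \<open>Subgroups of the lattice and their quotients\<close>

lemma lattice_group_simps [simp]:
  "carrier lattice_group = UNIV" "x \<otimes>\<^bsub>lattice_group\<^esub> y = x + y" "\<one>\<^bsub>lattice_group\<^esub> = 0"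
  by (simp_all add: lattice_group_def)

lemma comm_group_lattice_group: "comm_group (lattice_group :: (int ^ 'i) monoid)"
  by (rule comm_groupI) (auto intro: exI[of _ "- _"] left_minus)

lemma lattice_group_inv [simp]: "inv\<^bsub>lattice_group\<^esub> x = - (x :: int ^ 'i)"
proof -
  interpret comm_group "lattice_group :: (int ^ 'i) monoid" by (rule comm_group_lattice_group)
  show ?thesis
    by (rule inv_equality) simp_all
qed

lemma subgroup_lattice_group:
  "subgroup M (lattice_group :: (int ^ 'i) monoid) \<longleftrightarrow>
     0 \<in> M \<and> (\<forall>x\<in>M. \<forall>y\<in>M. x + y \<in> M) \<and> (\<forall>x\<in>M. - x \<in> M)"
  by (auto simp: subgroup_def)

context
  fixes M :: "(int ^ 'i) set"
  assumes M: "subgroup M lattice_group"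
begin

lemma subgroup_zero: "0 \<in> M"
  and subgroup_add: "x \<in> M \<Longrightarrow> y \<in> M \<Longrightarrow> x + y \<in> M"
  and subgroup_minus: "x \<in> M \<Longrightarrow> - x \<in> M"
  using M by (auto simp: subgroup_lattice_group)

lemma subgroup_diff: "x \<in> M \<Longrightarrow> y \<in> M \<Longrightarrow> x - y \<in> M"
  using subgroup_add[of x "- y"] subgroup_minus[of y] by simp

lemma subgroup_scale:
  assumes "x \<in> M" shows "k *s x \<in> M"
proof -
  have nat: "int n *s x \<in> M" for n
    by (induction n) (simp_all add: subgroup_zero subgroup_add assms vector_sadd_rdistrib)
  show ?thesis
  proof (cases "0 \<le> k")
    case True
    then show ?thesis using nat[of "nat k"] by simp
  next
    case False
    then have "- (int (nat (- k)) *s x) = k *s x" by (simp add: vec_eq_iff)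
    then show ?thesis using subgroup_minus[OF nat[of "nat (- k)"]] by simp
  qed
qed

lemma subgroup_sum: "(\<And>j. j \<in> J \<Longrightarrow> g j \<in> M) \<Longrightarrow> sum g J \<in> M"
  by (induction J rule: infinite_finite_induct) (auto simp: subgroup_zero subgroup_add)

lemma real_span_generators:
  obtains B where "finite B" "B \<subseteq> M" "real_span M = range (\<lambda>c. \<Sum>v\<in>B. c v *\<^sub>R emb v)"
proof -
  obtain B' where B': "B' \<subseteq> emb ` M" "independent B'" "emb ` M \<subseteq> span B'"
    using maximal_independent_subset by blast
  obtain B where B: "B \<subseteq> M" "B' = emb ` B"
    using B'(1) by (auto simp: subset_image_iff)
  have fin: "finite B"
    using finiteI_independent[OF B'(2)] inj_on_subset[OF inj_emb subset_UNIV]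
    unfolding B(2) by (rule finite_imageD)
  have "real_span M = span (emb ` B)"
    unfolding real_span_def B(2)[symmetric]
    by (metis B'(1,3) span_eq span_superset subset_trans)
  also have "\<dots> = range (\<lambda>c. \<Sum>v\<in>B. c (emb v) *\<^sub>R emb v)"
    using fin by (simp add: span_finite sum.reindex inj_on_subset[OF inj_emb])
  also have "\<dots> = range (\<lambda>c. \<Sum>v\<in>B. c v *\<^sub>R emb v)"
  proof (intro equalityI subsetI)
    fix x assume "x \<in> range (\<lambda>c. \<Sum>v\<in>B. c v *\<^sub>R emb v)"
    then obtain c where "x = (\<Sum>v\<in>B. c v *\<^sub>R emb v)" by blast
    then have "x = (\<Sum>v\<in>B. (c \<circ> inv_into UNIV emb) (emb v) *\<^sub>R emb v)"
      by (simp add: inv_f_f[OF inj_emb])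
    then show "x \<in> range (\<lambda>c. \<Sum>v\<in>B. c (emb v) *\<^sub>R emb v)" by blast
  qed force
  finally show thesis
    using that fin B(1) by blast
qed

lemma quot_map_eq_image: "quot_map M y = (\<lambda>m. m + y) ` M"
  by (auto simp: quot_map_def r_coset_def)

lemma quot_map_eq_iff: "quot_map M x = quot_map M y \<longleftrightarrow> x - y \<in> M"
proof
  assume "quot_map M x = quot_map M y"
  moreover have "x \<in> quot_map M x"
    using subgroup_zero by (force simp: quot_map_eq_image)
  ultimately obtain m where "m \<in> M" "x = m + y"
    by (auto simp: quot_map_eq_image)
  then show "x - y \<in> M" by simp
next
  have "quot_map M x \<subseteq> quot_map M y" if "x - y \<in> M" for x y
  proof
    fix w assume "w \<in> quot_map M x"
    then obtain m where "m \<in> M" "w = m + x" by (auto simp: quot_map_eq_image)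
    then have "w = (m + (x - y)) + y" "m + (x - y) \<in> M"
      using that by (auto intro: subgroup_add)
    then show "w \<in> quot_map M y" unfolding quot_map_eq_image by blast
  qed
  moreover assume "x - y \<in> M"
  moreover from this have "y - x \<in> M"
    using subgroup_minus by fastforce
  ultimately show "quot_map M x = quot_map M y" by blast
qed

lemma normal_lattice_group: "M \<lhd> lattice_group"
  using comm_group.subgroup_imp_normal[OF comm_group_lattice_group M] .

lemma carrier_Mod: "carrier (lattice_group Mod M) = range (quot_map M)"
  by (auto simp: FactGroup_def RCOSETS_def quot_map_def)

lemma Mod_mult: "quot_map M x \<otimes>\<^bsub>lattice_group Mod M\<^esub> quot_map M y = quot_map M (x + y)"
  using normal.rcos_sum[OF normal_lattice_group, of x y]
  by (simp add: FactGroup_def quot_map_def)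

lemma Mod_one: "\<one>\<^bsub>lattice_group Mod M\<^esub> = quot_map M 0"
  by (simp add: FactGroup_def quot_map_eq_image)

lemma Mod_pow: "quot_map M x [^]\<^bsub>lattice_group Mod M\<^esub> (n::nat) = quot_map M (int n *s x)"
proof -
  interpret group "lattice_group Mod M"
    by (rule normal.factorgroup_is_group[OF normal_lattice_group])
  show ?thesis
    by (induction n) (simp_all add: Mod_one Mod_mult vector_sadd_rdistrib add.commute
        del: mult_FactGroup one_FactGroup)
qed

lemma hom_Mod_lift:
  assumes "\<And>x. h x \<in> carrier G" "\<And>x y. h (x + y) = h x \<otimes>\<^bsub>G\<^esub> h y"
    and "\<And>x y. x - y \<in> M \<Longrightarrow> h x = h y"
  obtains \<psi> where "\<psi> \<in> hom (lattice_group Mod M) G" "\<And>y. \<psi> (quot_map M y) = h y"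
    "\<psi> \<in> extensional (carrier (lattice_group Mod M))"
proof
  define \<psi> where "\<psi> = (\<lambda>C\<in>carrier (lattice_group Mod M). h (SOME y. C = quot_map M y))"
  show \<psi>: "\<psi> (quot_map M y) = h y" for y
  proof -
    have "quot_map M y = quot_map M (SOME x. quot_map M y = quot_map M x)"
      by (rule someI[where P = "\<lambda>x. quot_map M y = quot_map M x"]) simp
    then have "h (SOME x. quot_map M y = quot_map M x) = h y"
      by (metis assms(3) quot_map_eq_iff)
    then show ?thesis by (simp add: \<psi>_def carrier_Mod)
  qed
  show "\<psi> \<in> hom (lattice_group Mod M) G"
    by (rule homI) (auto simp: carrier_Mod Mod_mult \<psi> assms simp del: mult_FactGroup)
  show "\<psi> \<in> extensional (carrier (lattice_group Mod M))"
    by (simp add: \<psi>_def)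
qed

lemma torsion_free_Mod:
  assumes "torsion_free (lattice_group Mod M)" "N *s x \<in> M" "0 < N"
  shows "x \<in> M"
proof -
  have "quot_map M x [^]\<^bsub>lattice_group Mod M\<^esub> nat N = \<one>\<^bsub>lattice_group Mod M\<^esub>"
    using assms(2,3) by (simp add: Mod_pow Mod_one quot_map_eq_iff del: one_FactGroup)
  then have "quot_map M x = \<one>\<^bsub>lattice_group Mod M\<^esub>"
    using assms(1,3) unfolding torsion_free_def carrier_Mod by (metis rangeI zero_less_nat_eq)
  then show ?thesis by (simp add: Mod_one quot_map_eq_iff del: one_FactGroup)
qed

text \<open>
  Torsion-freeness of the quotient says that \<open>M\<close> is saturated.  Some multiple of a lattice point of
  \<open>M\<^sub>R\<close> differs from an element of \<open>M\<close> by less than \<open>1\<close> in every coordinate, hence is equal to it.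
\<close>

lemma real_span_Int_lattice:
  assumes "torsion_free (lattice_group Mod M)"
  shows "emb x \<in> real_span M \<longleftrightarrow> x \<in> M"
proof
  assume x: "emb x \<in> real_span M"
  obtain B c where B: "finite B" "B \<subseteq> M" and c: "emb x = (\<Sum>v\<in>B. c v *\<^sub>R emb v)"
    using x real_span_generators by (metis (no_types, lifting) rangeE)
  obtain N p where N: "0 < N" and p: "\<And>i. i \<in> (UNIV :: 'i set) \<Longrightarrow>
      \<bar>of_int N * (\<Sum>v\<in>B. c v * of_int (v $ i)) - of_int (\<Sum>v\<in>B. p v * v $ i)\<bar> < 1"
    using Dirichlet_approx_matrix[OF B(1) finite_class.finite_UNIV zero_less_one,
        where c = c and A = "\<lambda>v i. v $ i"] by blast
  have "N *s x = (\<Sum>v\<in>B. p v *s v)"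
  proof (rule vec_eq_iff[THEN iffD2, rule_format])
    fix i
    have "(\<Sum>v\<in>B. c v * of_int (v $ i)) = of_int (x $ i)"
      using arg_cong[OF c, of "\<lambda>w. w $ i"] by simp
    then have "\<bar>real_of_int (N * x $ i - (\<Sum>v\<in>B. p v * v $ i))\<bar> < 1"
      using p[of i] by simp
    then have "N * x $ i = (\<Sum>v\<in>B. p v * v $ i)"
      by linarith
    then show "(N *s x) $ i = (\<Sum>v\<in>B. p v *s v) $ i" by simp
  qed
  also have "\<dots> \<in> M"
    using B(2) by (intro subgroup_sum subgroup_scale) auto
  finally show "x \<in> M"
    using torsion_free_Mod[OF assms] N by blast
qed (simp add: real_span_def span_base)

text \<open>
  An integral form of Gordan's alternative.  Over the reals it is the separation of \<open>M\<^sub>R\<close> from the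
  open positive orthant; either outcome is then approximated by integers, and the approximation is exact where
  it has to be because the pairing of two integral vectors is an integer.
\<close>

lemma positive_element_or_dual:
  obtains m where "m \<in> M" "\<And>i. 0 < m $ i"
  | p :: "int ^ 'i" where "p \<noteq> 0" "\<And>i. 0 \<le> p $ i" "\<And>m. m \<in> M \<Longrightarrow> (\<Sum>i\<in>UNIV. p $ i * m $ i) = 0"
proof -
  obtain B where B: "finite B" "B \<subseteq> M" and span: "real_span M = range (\<lambda>c. \<Sum>v\<in>B. c v *\<^sub>R emb v)"
    using real_span_generators by blast
  define pos :: "(real ^ 'i) set" where "pos = {v. \<forall>i. 0 < v $ i}"
  show thesis
  proof (cases "real_span M \<inter> pos = {}")
    case False
    then obtain c where c: "(\<Sum>v\<in>B. c v *\<^sub>R emb v) \<in> pos"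
      unfolding span by blast
    define u where "u = (\<Sum>v\<in>B. c v *\<^sub>R emb v)"
    define \<delta> where "\<delta> = Min (range (\<lambda>i. u $ i))"
    have \<delta>: "0 < \<delta>" "\<And>i. \<delta> \<le> u $ i"
      using c by (auto simp: \<delta>_def pos_def u_def)
    obtain N p where N: "0 < N" and p: "\<And>i. i \<in> (UNIV :: 'i set) \<Longrightarrow>
        \<bar>of_int N * (\<Sum>v\<in>B. c v * of_int (v $ i)) - of_int (\<Sum>v\<in>B. p v * v $ i)\<bar> < \<delta>"
      using Dirichlet_approx_matrix[OF B(1) finite_class.finite_UNIV \<delta>(1),
          where c = c and A = "\<lambda>v i. v $ i"] by blast
    have "0 < (\<Sum>v\<in>B. p v *s v) $ i" for i
    proof -
      have "\<delta> \<le> (\<Sum>v\<in>B. c v * of_int (v $ i))"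
        using \<delta>(2)[of i] by (simp add: u_def)
      also have "\<dots> \<le> of_int N * (\<Sum>v\<in>B. c v * of_int (v $ i))"
        using N calculation \<delta>(1) by (simp add: mult_le_cancel_right1)
      finally have "0 < real_of_int (\<Sum>v\<in>B. p v * v $ i)"
        using p[of i] by simp
      then show ?thesis by (simp only: of_int_0_less_iff) simp
    qed
    moreover have "(\<Sum>v\<in>B. p v *s v) \<in> M"
      using B(2) by (intro subgroup_sum subgroup_scale) auto
    ultimately show thesis using that(1) by blast
  next
    case True
    have "0 < u * x + v * y" if "0 \<le> u" "0 \<le> v" "u + v = 1" "0 < x" "0 < y" for u v x y :: real
      using that by (cases "u = 0") (auto intro: add_pos_nonneg)
    then have "convex pos"
      unfolding pos_def convex_def by simp
    have "(\<chi> i. 1) \<in> pos" by (simp add: pos_def)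
    have "subspace (real_span M)" by (simp add: real_span_def)
    obtain t b where t: "t \<noteq> 0" "\<And>v. v \<in> real_span M \<Longrightarrow> t \<bullet> v \<le> b" "\<And>v. v \<in> pos \<Longrightarrow> b \<le> t \<bullet> v"
      using separating_hyperplane_sets[of "real_span M" pos] True \<open>convex pos\<close> \<open>(\<chi> i. 1) \<in> pos\<close>
        subspace_imp_convex[OF \<open>subspace (real_span M)\<close>] subspace_0[OF \<open>subspace (real_span M)\<close>]
      by blast
    have "0 \<le> b"
      using t(2)[OF subspace_0[OF \<open>subspace (real_span M)\<close>]] by simp
    have orth: "t \<bullet> v = 0" if v: "v \<in> real_span M" for v
    proof (rule ccontr)
      assume "t \<bullet> v \<noteq> 0"
      then have "t \<bullet> (((b + 1) / (t \<bullet> v)) *\<^sub>R v) = b + 1"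
        by simp
      then show False
        using t(2)[OF subspace_scale[OF \<open>subspace (real_span M)\<close> v, of "(b + 1) / (t \<bullet> v)"]]
        by simp
    qed
    have nonneg: "0 \<le> t $ i" for i
    proof (rule ccontr)
      assume neg: "\<not> 0 \<le> t $ i"
      define S where "S = (\<Sum>j\<in>UNIV. \<bar>t $ j\<bar>)"
      \<comment> \<open>the weight at \<open>i\<close> makes \<open>t \<bullet> v\<close> equal to \<open>(\<Sum>j. t $ j) - (S + 1)\<close>, which is negative\<close>
      define v :: "real ^ 'i" where "v = (\<chi> j. if j = i then 1 + (S + 1) / - (t $ i) else 1)"
      have "0 \<le> S" by (simp add: S_def sum_nonneg)
      then have "v \<in> pos"
        using neg by (auto simp: v_def pos_def add_pos_nonneg divide_nonneg_neg)
      have "t \<bullet> v = (\<Sum>j\<in>UNIV. t $ j + (if j = i then - (S + 1) else 0))"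
        unfolding inner_vec_def using neg by (intro sum.cong) (auto simp: v_def field_simps)
      also have "\<dots> = (\<Sum>j\<in>UNIV. t $ j) - (S + 1)"
        by (simp add: sum.distrib)
      also have "\<dots> < 0"
      proof -
        have "(\<Sum>j\<in>UNIV. t $ j) \<le> S"
          unfolding S_def by (intro sum_mono) simp
        then show ?thesis by simp
      qed
      finally show False using t(3)[OF \<open>v \<in> pos\<close>] \<open>0 \<le> b\<close> by simp
    qed
    obtain i0 where i0: "0 < t $ i0"
      using t(1) nonneg by (metis antisym_conv2 vec_eq_iff zero_index)
    define \<delta> where "\<delta> = min 1 (t $ i0)"
    have "0 < \<delta>" using i0 by (simp add: \<delta>_def)
    obtain N p where N: "0 < N" and p: "\<And>i. i \<in> (UNIV :: 'i set) \<Longrightarrow> \<bar>of_int N * t $ i - of_int (p i)\<bar> < \<delta>"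
      "\<And>m. m \<in> B \<Longrightarrow> \<bar>of_int N * (\<Sum>i\<in>UNIV. t $ i * of_int (m $ i)) - of_int (\<Sum>i\<in>UNIV. p i * m $ i)\<bar> < \<delta>"
      using Dirichlet_approx_matrix[OF finite_class.finite_UNIV B(1) \<open>0 < \<delta>\<close>,
          where c = "\<lambda>i. t $ i" and A = "\<lambda>i m. m $ i"] by blast
    have N1: "1 \<le> real_of_int N" using N by simp
    show thesis
    proof (rule that(2)[of "\<chi> i. p i"])
      have "t $ i0 \<le> of_int N * t $ i0"
        using N1 i0 by (simp add: mult_le_cancel_right1)
      then have "0 < p i0"
        using p(1)[of i0] by (simp add: \<delta>_def) linarith
      then show "(\<chi> i. p i) \<noteq> 0"
        by (auto simp: vec_eq_iff intro!: exI[of _ i0])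
      fix i
      have "0 \<le> of_int N * t $ i" using N nonneg by simp
      then show "0 \<le> (\<chi> i. p i) $ i"
        using p(1)[of i] by (simp add: \<delta>_def) linarith
    next
      have pB: "(\<Sum>i\<in>UNIV. p i * v $ i) = 0" if v: "v \<in> B" for v
      proof -
        have "emb v \<in> real_span M"
          using v B(2) by (auto simp: real_span_def intro: span_base)
        then have "(\<Sum>i\<in>UNIV. t $ i * of_int (v $ i)) = 0"
          using orth by (force simp: inner_vec_def)
        then have "\<bar>real_of_int (\<Sum>i\<in>UNIV. p i * v $ i)\<bar> < 1"
          using p(2)[OF v] by (simp add: \<delta>_def)
        then show ?thesis by linarith
      qed
      fix m assume "m \<in> M"
      then have "emb m \<in> real_span M"
        by (simp add: real_span_def span_base)
      then obtain c where c: "emb m = (\<Sum>v\<in>B. c v *\<^sub>R emb v)"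
        unfolding span by blast
      have "real_of_int (\<Sum>i\<in>UNIV. p i * m $ i) = (\<Sum>i\<in>UNIV. of_int (p i) * emb m $ i)"
        by simp
      also have "\<dots> = (\<Sum>i\<in>UNIV. \<Sum>v\<in>B. c v * (of_int (p i) * of_int (v $ i)))"
        unfolding c by (simp add: sum_distrib_left mult.left_commute)
      also have "\<dots> = (\<Sum>v\<in>B. c v * of_int (\<Sum>i\<in>UNIV. p i * v $ i))"
        by (subst sum.swap) (simp add: sum_distrib_left)
      also have "\<dots> = 0"
        by (simp add: pB)
      finally show "(\<Sum>i\<in>UNIV. (\<chi> i. p i) $ i * m $ i) = 0"
        unfolding vec_lambda_beta of_int_eq_0_iff .
    qed
  qed
qed

lemma positive_element:
  assumes "Gamma_dual M \<inter> dual_cone Lambda = {0}"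
  obtains m where "m \<in> M" "\<And>i. 0 < m $ i"
proof (cases rule: positive_element_or_dual)
  case (2 p)
  obtain \<psi> where "\<psi> \<in> hom (lattice_group Mod M) integer_group"
    "\<And>y. \<psi> (quot_map M y) = (\<Sum>i\<in>UNIV. p $ i * y $ i)"
  proof (rule hom_Mod_lift[of "\<lambda>y. \<Sum>i\<in>UNIV. p $ i * y $ i" integer_group])
    show "(\<Sum>i\<in>UNIV. p $ i * x $ i) = (\<Sum>i\<in>UNIV. p $ i * y $ i)" if "x - y \<in> M" for x y
      using 2(3)[OF that] by (simp add: algebra_simps sum_subtractf)
  qed (auto simp: sum.distrib algebra_simps)
  then have "emb p \<in> Gamma_dual M"
    unfolding Gamma_dual_def by (auto simp: inner_vec_def mult.commute intro!: bexI[of _ \<psi>])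
  moreover have "emb p \<in> dual_cone Lambda"
    by (auto simp: dual_cone_def Lambda_eq inner_vec_def 2(2) intro!: sum_nonneg)
  ultimately have "emb p = emb 0"
    using assms by auto
  then show ?thesis using 2(1) by (simp only: emb_eq_iff)
qed (use that in blast)

end

section \<open>Absolutely convergent series over nonnegative vectors\<close>

definition nonneg_vecs :: "(int ^ 'i) set" where
  "nonneg_vecs = {y. \<forall>i. 0 \<le> y $ i}"

definition height :: "int ^ 'i \<Rightarrow> real" where
  "height y = (\<Sum>i\<in>UNIV. real_of_int (y $ i))"

lemma emb_mem_Lambda: "emb y \<in> Lambda \<longleftrightarrow> y \<in> nonneg_vecs"
  by (simp add: Lambda_eq nonneg_vecs_def)

lemma nonneg_vecs_add: "x \<in> nonneg_vecs \<Longrightarrow> y \<in> nonneg_vecs \<Longrightarrow> x + y \<in> nonneg_vecs"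
  by (simp add: nonneg_vecs_def)

lemma height_nonneg: "y \<in> nonneg_vecs \<Longrightarrow> 0 \<le> height y"
  by (simp add: height_def nonneg_vecs_def sum_nonneg)

lemma L_conv_Lambda:
  "L_conv UNIV Lambda b z \<longleftrightarrow> (\<lambda>y. norm (b y * z y)) summable_on nonneg_vecs"
  by (simp add: L_conv_def emb_mem_Lambda)

lemma L_fun_Lambda: "L_fun UNIV Lambda b z = (\<Sum>\<^sub>\<infinity>y\<in>nonneg_vecs. b y * z y)"
  by (simp add: L_fun_def emb_mem_Lambda)

lemma q_pow_add: "q_pow q s (x + y) = q_pow q s x * q_pow q s y"
  by (simp add: q_pow_def pairing_def sum.distrib algebra_simps powr_add[symmetric])

lemma q_pow_0 [simp]: "0 < q \<Longrightarrow> q_pow q s 0 = 1"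
  by (simp add: q_pow_def pairing_def)

lemma norm_q_pow:
  "norm (q_pow q s y) = real q powr (- (\<Sum>i\<in>UNIV. real_of_int (y $ i) * Re (s $ i)))"
  using norm_powr_real_powr[of "of_nat q" "- pairing y s"]
  by (simp add: q_pow_def pairing_def Re_sum)

lemma norm_q_pow_le:
  assumes "1 < q" "y \<in> nonneg_vecs" "\<And>i. \<delta> \<le> Re (s $ i)"
  shows "norm (q_pow q s y) \<le> real q powr (- \<delta> * height y)"
proof -
  have "(\<Sum>i\<in>UNIV. real_of_int (y $ i) * \<delta>) \<le> (\<Sum>i\<in>UNIV. real_of_int (y $ i) * Re (s $ i))"
    using assms(2,3) by (intro sum_mono mult_left_mono) (auto simp: nonneg_vecs_def)
  then have "- (\<Sum>i\<in>UNIV. real_of_int (y $ i) * Re (s $ i)) \<le> - \<delta> * height y"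
    by (simp add: height_def sum_distrib_left mult.commute sum_negf)
  then show ?thesis
    unfolding norm_q_pow using assms(1) by (intro powr_mono) auto
qed

lemma tube_iff: "s \<in> tube (Lambda_dual_gt \<eta>) \<longleftrightarrow> (\<forall>i. \<eta> < Re (s $ i))"
proof -
  have *: "(\<Sum>i\<in>UNIV. c i *\<^sub>R axis i 1) = (\<chi> i. c i)" for c :: "'i::finite \<Rightarrow> real"
    by (simp add: vec_eq_iff axis_def if_distrib cong: if_cong)
  show ?thesis
    unfolding tube_def Lambda_dual_gt_def * by (auto simp: vec_eq_iff)
qed

lemma tube_lower_bound:
  assumes "s \<in> tube (Lambda_dual_gt \<eta>)"
  obtains \<delta> where "\<eta> < \<delta>" "\<And>i. \<delta> \<le> Re (s $ i)"
proof
  show "\<eta> < Min (range (\<lambda>i. Re (s $ i)))"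
    using assms by (auto simp: tube_iff)
qed auto

lemma open_tube: "open (tube (Lambda_dual_gt \<eta>))"
proof -
  have "tube (Lambda_dual_gt \<eta>) = (\<Inter>i. {s :: complex ^ 'a. \<eta> < Re (s $ i)})"
    by (auto simp: tube_iff)
  also have "open \<dots>"
    by (intro open_INT ballI open_Collect_less continuous_intros) auto
  finally show ?thesis .
qed

lemma has_sum_times:
  fixes f :: "'a \<Rightarrow> 'c::{real_normed_algebra,banach}"
  assumes "(\<lambda>x. norm (f x)) summable_on A" "(\<lambda>y. norm (g y)) summable_on B"
  shows "((\<lambda>(x,y). f x * g y) has_sum (infsum f A * infsum g B)) (A \<times> B)"
    and "(\<lambda>(x,y). norm (f x * g y)) summable_on (A \<times> B)"
proof -
  note summable = assms[THEN abs_summable_summable]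
  have "(\<lambda>(x,y). norm (f x) * norm (g y)) summable_on (A \<times> B)"
    by (rule summable_on_SigmaI[where g = "\<lambda>x. norm (f x) * (\<Sum>\<^sub>\<infinity>y\<in>B. norm (g y))"])
       (auto intro!: has_sum_cmult_right has_sum_infsum summable_on_cmult_left assms)
  then show abs: "(\<lambda>(x,y). norm (f x * g y)) summable_on (A \<times> B)"
    by (rule summable_on_comparison_test) (auto simp: norm_mult_ineq)
  show "((\<lambda>(x,y). f x * g y) has_sum (infsum f A * infsum g B)) (A \<times> B)"
  proof (rule has_sum_SigmaI)
    show "((\<lambda>y. case (x, y) of (x, y) \<Rightarrow> f x * g y) has_sum f x * infsum g B) B" for x
      by (simp add: has_sum_cmult_right has_sum_infsum summable)
    show "((\<lambda>x. f x * infsum g B) has_sum infsum f A * infsum g B) A"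
      by (intro has_sum_cmult_left has_sum_infsum summable)
  qed (rule abs_summable_summable, use abs in \<open>simp add: case_prod_unfold\<close>)
qed

lemma summable_powr_height:
  assumes "1 < q" "0 < \<delta>"
  shows "(\<lambda>y :: int ^ 'i. real q powr (- \<delta> * height y)) summable_on nonneg_vecs"
proof -
  define x where "x = real q powr (- \<delta>)"
  have x: "0 < x" "x < 1"
    using assms powr_less_mono[of "- \<delta>" 0 "real q"] by (auto simp: x_def)
  have geo: "(\<lambda>n::nat. norm (x ^ n)) summable_on UNIV"
    using x by (simp add: summable_on_UNIV_nonneg_real_iff summable_geometric)
  \<comment> \<open>a sum that does not converge has the value \<open>0\<close>, so a nonzero value proves convergence\<close>
  have "infsum (\<lambda>n::nat. x ^ n) UNIV > 0"
    using finite_sum_le_infsum[OF abs_summable_summable[OF geo], of "{0}"] x by simp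
  then have "infsum (\<lambda>g. \<Prod>i\<in>UNIV. x ^ g i) (PiE (UNIV :: 'i set) (\<lambda>_. UNIV :: nat set)) \<noteq> 0"
    using geo by (subst infsum_prod_PiE_abs) auto
  then have s: "(\<lambda>g::'i \<Rightarrow> nat. \<Prod>i\<in>UNIV. x ^ g i) summable_on UNIV"
    using infsum_not_exists by (metis PiE_UNIV)
  have bij: "bij_betw (\<lambda>g::'i \<Rightarrow> nat. \<chi> i. int (g i)) UNIV nonneg_vecs"
    by (rule bij_betw_byWitness[where f' = "\<lambda>y i. nat (y $ i)"])
       (auto simp: nonneg_vecs_def vec_eq_iff)
  have eq: "(\<Prod>i\<in>UNIV. x ^ g i) = real q powr (- \<delta> * height (\<chi> i. int (g i)))" for g :: "'i \<Rightarrow> nat"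
  proof -
    have "(\<Prod>i\<in>UNIV. x ^ g i) = (\<Prod>i\<in>UNIV. real q powr (- \<delta> * real (g i)))"
      using assms(1) by (simp add: x_def powr_power mult.commute)
    also have "\<dots> = real q powr (\<Sum>i\<in>UNIV. - \<delta> * real (g i))"
      using assms(1) by (simp add: powr_sum)
    finally show ?thesis
      by (simp add: height_def sum_distrib_left)
  qed
  from s show ?thesis
    unfolding eq by (subst (asm) summable_on_reindex_bij_betw[OF bij])
qed

lemma summable_on_q_pow:
  assumes "1 < q" "s \<in> tube (Lambda_dual_gt 0)"
  shows "(\<lambda>y. norm (q_pow q s y)) summable_on nonneg_vecs"
proof -
  obtain \<delta> where \<delta>: "0 < \<delta>" "\<And>i. \<delta> \<le> Re (s $ i)"
    using tube_lower_bound[OF assms(2)] by blast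
  show ?thesis
    by (rule summable_on_comparison_test[OF summable_powr_height[OF assms(1) \<delta>(1)]])
       (use norm_q_pow_le[OF assms(1) _ \<delta>(2)] in auto)
qed

text \<open>
  In practice an elementary admissible function arises as a series over an index set other than the lattice,
  with exponents \<open>E t\<close>; its coefficients as a lattice series are the sums over the fibres of \<open>E\<close>.
\<close>

lemma elem_admissible_0_fibres:
  fixes E :: "'t \<Rightarrow> int ^ 'i"
  assumes q: "1 < q" and \<eta>: "0 < \<eta>" and E: "\<And>t. t \<in> T \<Longrightarrow> E t \<in> nonneg_vecs"
    and sum: "(\<lambda>t. norm (\<alpha> t) * real q powr (\<eta> * height (E t))) summable_on T"
    and f: "\<And>s. s \<in> tube (Lambda_dual_gt 0) \<Longrightarrow> f s = (\<Sum>\<^sub>\<infinity>t\<in>T. \<alpha> t * q_pow q s (E t))"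
  shows "elem_admissible_0 q f"
proof -
  define fib where "fib y = {t\<in>T. E t = y}" for y
  define b where "b y = (\<Sum>\<^sub>\<infinity>t\<in>fib y. \<alpha> t)" for y
  have bij: "bij_betw (\<lambda>t. (E t, t)) T (Sigma nonneg_vecs fib)"
    by (rule bij_betw_byWitness[where f' = snd]) (auto simp: fib_def E)
  have main: "(\<lambda>(y, t). \<alpha> t * q_pow q s y) summable_on Sigma nonneg_vecs fib \<and>
      (\<Sum>\<^sub>\<infinity>t\<in>T. \<alpha> t * q_pow q s (E t)) = (\<Sum>\<^sub>\<infinity>(y, t)\<in>Sigma nonneg_vecs fib. \<alpha> t * q_pow q s y)"
    if "s \<in> tube (Lambda_dual_gt (- \<eta>))" for s
  proof -
    have "(\<lambda>t. norm (\<alpha> t * q_pow q s (E t))) summable_on T"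
    proof (rule summable_on_comparison_test[OF sum])
      fix t assume "t \<in> T"
      have "norm (q_pow q s (E t)) \<le> real q powr (- (- \<eta>) * height (E t))"
        using that by (intro norm_q_pow_le q E \<open>t \<in> T\<close>) (auto simp: tube_iff less_imp_le)
      then show "norm (\<alpha> t * q_pow q s (E t)) \<le> norm (\<alpha> t) * real q powr (\<eta> * height (E t))"
        by (simp add: norm_mult mult_left_mono)
    qed auto
    then have "(\<lambda>t. \<alpha> t * q_pow q s (E t)) summable_on T"
      by (rule abs_summable_summable)
    then show ?thesis
      using summable_on_reindex_bij_betw[OF bij, of "\<lambda>(y, t). \<alpha> t * q_pow q s y"]
        infsum_reindex_bij_betw[OF bij, of "\<lambda>(y, t). \<alpha> t * q_pow q s y"]
      by simp
  qed
  have b: "(\<Sum>\<^sub>\<infinity>t\<in>fib y. \<alpha> t * q_pow q s y) = b y * q_pow q s y" for s y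
    unfolding b_def by (rule infsum_cmult_left')
  show ?thesis
    unfolding elem_admissible_0_def
  proof (intro exI[of _ b] conjI exI[of _ \<eta>] ballI \<eta>)
    fix s :: "complex ^ 'i" assume "s \<in> tube (Lambda_dual_gt (- \<eta>))"
    then show "L_conv UNIV Lambda b (q_pow q s)"
      using summable_on_Sigma_banach[of "\<lambda>y t. \<alpha> t * q_pow q s y" nonneg_vecs fib] main
      by (simp add: L_conv_Lambda b summable_on_iff_abs_summable_on_complex)
  next
    fix s :: "complex ^ 'i" assume s: "s \<in> tube (Lambda_dual_gt 0)"
    then have "s \<in> tube (Lambda_dual_gt (- \<eta>))"
      using \<eta> by (auto simp: tube_iff intro: less_trans[of _ 0])
    then show "f s = L_fun UNIV Lambda b (q_pow q s)"
      using infsum_Sigma'_banach[of "\<lambda>y t. \<alpha> t * q_pow q s y" nonneg_vecs fib] main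
      by (simp add: f[OF s] L_fun_Lambda b)
  qed
qed

section \<open>Normal forms in the monoid of nonnegative elements\<close>

text \<open>
  Dickson's lemma.  When a coordinate \<open>i\<close> is added, either the value at \<open>i\<close> is so large that the finite
  set for the other coordinates suffices, or it is one of finitely many values, each with a finite set of its own.
\<close>

lemma Dickson:
  fixes f :: "'a \<Rightarrow> 'b \<Rightarrow> nat"
  assumes "finite S"
  shows "\<exists>B\<subseteq>A. finite B \<and> (\<forall>a\<in>A. \<exists>b\<in>B. \<forall>i\<in>S. f b i \<le> f a i)"
  using assms
proof (induction S arbitrary: A)
  case empty
  show ?case
  proof (cases "A = {}")
    case False
    then obtain a where "a \<in> A" by blast
    then show ?thesis by (intro exI[of _ "{a}"]) auto
  qed auto
next
  case (insert i S)
  from insert.IH[of A] obtain B where B: "B \<subseteq> A" "finite B"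
    "\<And>a. a \<in> A \<Longrightarrow> \<exists>b\<in>B. \<forall>i\<in>S. f b i \<le> f a i" by blast
  define n where "n = (\<Sum>b\<in>B. f b i)"
  have "\<forall>j. \<exists>C\<subseteq>{a\<in>A. f a i = j}. finite C \<and>
      (\<forall>a\<in>{a\<in>A. f a i = j}. \<exists>b\<in>C. \<forall>i\<in>S. f b i \<le> f a i)"
    using insert.IH by blast
  from choice[OF this] obtain C where C': "\<forall>j. C j \<subseteq> {a\<in>A. f a i = j} \<and> finite (C j) \<and>
      (\<forall>a\<in>{a\<in>A. f a i = j}. \<exists>b\<in>C j. \<forall>i\<in>S. f b i \<le> f a i)" ..
  then have C: "C j \<subseteq> {a\<in>A. f a i = j}" "finite (C j)"
    "a \<in> A \<Longrightarrow> f a i = j \<Longrightarrow> \<exists>b\<in>C j. \<forall>i\<in>S. f b i \<le> f a i" for j a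
    by simp_all
  show ?case
  proof (intro exI[of _ "B \<union> (\<Union>j<n. C j)"] conjI ballI)
    show "B \<union> (\<Union>j<n. C j) \<subseteq> A" using B(1) C(1) by blast
    show "finite (B \<union> (\<Union>j<n. C j))" using B(2) C(2) by simp
    fix a assume a: "a \<in> A"
    show "\<exists>b\<in>B \<union> (\<Union>j<n. C j). \<forall>i\<in>insert i S. f b i \<le> f a i"
    proof (cases "f a i < n")
      case True
      then obtain b where "b \<in> C (f a i)" "\<forall>i\<in>S. f b i \<le> f a i" using C(3)[OF a] by blast
      moreover from this have "f b i = f a i" using C(1) by blast
      ultimately show ?thesis using True by (intro bexI[of _ b]) auto
    next
      case False
      obtain b where b: "b \<in> B" "\<forall>i\<in>S. f b i \<le> f a i" using B(3)[OF a] by blast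
      have "f b i \<le> n" unfolding n_def using b(1) B(2) by (intro member_le_sum) auto
      then show ?thesis using b False by (intro bexI[of _ b]) auto
    qed
  qed
qed

definition supp_in :: "'b set \<Rightarrow> ('b \<Rightarrow> nat) set" where
  "supp_in V = {k. \<forall>v. v \<notin> V \<longrightarrow> k v = 0}"

lemma supp_in_add: "k \<in> supp_in V \<Longrightarrow> l \<in> supp_in V \<Longrightarrow> (\<lambda>v. k v + l v) \<in> supp_in V"
  by (simp add: supp_in_def)

text \<open>
  Assigning distinct primes to the elements of \<open>V\<close> gives a translation-invariant well-order on the
  finitely supported functions, with all of its properties inherited from multiplication of natural numbers.
\<close>

lemma Goedel_numbering:
  fixes V :: "'b set"
  assumes "finite V"
  obtains code :: "('b \<Rightarrow> nat) \<Rightarrow> nat" where "inj_on code (supp_in V)" "\<And>k. 0 < code k"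
    "\<And>k l. code (\<lambda>v. k v + l v) = code k * code l"
proof -
  obtain P where P: "P \<subseteq> {p::nat. prime p}" "finite P" "card P = card V"
    using infinite_arbitrarily_large[OF primes_infinite] by metis
  obtain \<pi> where \<pi>: "bij_betw \<pi> V P"
    using finite_same_card_bij[OF assms P(2)] P(3) by auto
  define code where "code k = (\<Prod>v\<in>V. \<pi> v ^ k v)" for k :: "'b \<Rightarrow> nat"
  have prime: "prime (\<pi> v)" if "v \<in> V" for v
    using that \<pi> P(1) by (auto simp: bij_betw_def)
  have mult: "multiplicity (\<pi> v) (code k) = k v" if v: "v \<in> V" for v k
  proof -
    have "code k = (\<Prod>p\<in>P. p ^ k (inv_into V \<pi> p))"
      unfolding code_def using \<pi> 
      by (subst prod.reindex_bij_betw[OF \<pi>, symmetric]) (auto simp: bij_betw_def inv_into_f_f)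
    moreover have "\<pi> v \<in> P" "inv_into V \<pi> (\<pi> v) = v"
      using v \<pi> by (auto simp: bij_betw_def inv_into_f_f)
    ultimately show ?thesis
      using multiplicity_prod_prime_powers[OF P(2), of "\<pi> v" "\<lambda>p. k (inv_into V \<pi> p)"] P(1) prime[OF v]
      by auto
  qed
  show thesis
  proof
    show "inj_on code (supp_in V)"
    proof (rule inj_onI, rule ext)
      fix k l v assume "k \<in> supp_in V" "l \<in> supp_in V" "code k = code l"
      then show "k v = l v"
        using mult[of v k] mult[of v l] by (cases "v \<in> V") (auto simp: supp_in_def)
    qed
    show "0 < code k" for k
      using prime prime_gt_0_nat by (auto simp: code_def intro!: prod_pos)
    show "code (\<lambda>v. k v + l v) = code k * code l" for k l
      by (simp add: code_def power_add prod.distrib)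
  qed
qed

text \<open>
  In every fibre of \<open>h\<close> the function of least code is chosen.  Since codes are multiplicative, translating
  a non-minimal function gives a non-minimal one, so the complement of \<open>D\<close> is an up-set.  By Dickson's
  lemma this up-set has finitely many minimal elements; beyond a bound \<open>K\<close> on their entries, membership in
  \<open>D\<close> no longer depends on the size of a coefficient.  (This is the initial ideal of a toric ideal, whose
  standard monomials are the normal forms.)
\<close>

lemma normal_forms:
  fixes h :: "('b \<Rightarrow> nat) \<Rightarrow> 'c::ab_semigroup_add"
  assumes V: "finite V" and add: "\<And>k l. h (\<lambda>v. k v + l v) = h k + h l"
  shows "\<exists>D K::nat. D \<subseteq> supp_in V \<and> bij_betw h D (h ` supp_in V) \<and>
    (\<forall>k\<in>supp_in V. \<forall>l\<in>supp_in V. (\<lambda>v. k v + l v) \<in> D \<longrightarrow> k \<in> D) \<and>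
    (\<forall>k\<in>D. \<forall>l\<in>supp_in V. (\<forall>v. 0 < l v \<longrightarrow> K \<le> k v) \<longrightarrow> (\<lambda>v. k v + l v) \<in> D)"
proof -
  obtain code :: "('b \<Rightarrow> nat) \<Rightarrow> nat" where code: "inj_on code (supp_in V)" "\<And>k. 0 < code k"
    "\<And>k l. code (\<lambda>v. k v + l v) = code k * code l"
    using Goedel_numbering[OF V] by blast
  define D where "D = {k \<in> supp_in V. \<forall>k'\<in>supp_in V. h k' = h k \<longrightarrow> code k \<le> code k'}"
  define U where "U = supp_in V - D"
  obtain B where B: "B \<subseteq> U" "finite B" "\<And>k. k \<in> U \<Longrightarrow> \<exists>u\<in>B. \<forall>v\<in>V. u v \<le> k v"
    using Dickson[OF V, of U "\<lambda>k. k"] by blast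
  define K where "K = (\<Sum>u\<in>B. \<Sum>v\<in>V. u v)"
  have K: "u v \<le> K" if "u \<in> B" "v \<in> V" for u v
  proof -
    have "u v \<le> (\<Sum>v\<in>V. u v)" using that V by (intro member_le_sum) auto
    also have "\<dots> \<le> K" unfolding K_def using that B(2) by (intro member_le_sum) auto
    finally show ?thesis .
  qed
  have D_sub: "D \<subseteq> supp_in V" by (auto simp: D_def)
  have inj: "inj_on h D"
  proof (rule inj_onI)
    fix k l assume "k \<in> D" "l \<in> D" "h k = h l"
    then have "code k = code l" "k \<in> supp_in V" "l \<in> supp_in V"
      by (auto simp: D_def intro: antisym)
    then show "k = l" using code(1) by (simp add: inj_on_def)
  qed
  have surj: "h k \<in> h ` D" if k: "k \<in> supp_in V" for k
  proof -
    obtain k' where k': "k' \<in> supp_in V \<and> h k' = h k"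
      "\<And>l. l \<in> supp_in V \<and> h l = h k \<Longrightarrow> code k' \<le> code l"
      using ex_has_least_nat[of "\<lambda>l. l \<in> supp_in V \<and> h l = h k" k code] k by blast
    then have "k' \<in> D" by (auto simp: D_def)
    then show ?thesis using k' by (metis imageI)
  qed
  have up: "(\<lambda>v. k v + l v) \<in> U" if k: "k \<in> U" and l: "l \<in> supp_in V" for k l
  proof -
    obtain k' where k': "k' \<in> supp_in V" "h k' = h k" "code k' < code k"
      using k by (auto simp: U_def D_def not_le)
    have "code (\<lambda>v. k' v + l v) < code (\<lambda>v. k v + l v)"
      using k'(3) code(2) by (simp add: code(3))
    moreover have "h (\<lambda>v. k' v + l v) = h (\<lambda>v. k v + l v)"
      by (simp add: add k'(2))
    ultimately show ?thesis
      using k k'(1) l supp_in_add[of _ V l] by (fastforce simp: U_def D_def not_le)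
  qed
  show ?thesis
  proof (intro exI[of _ D] exI[of _ K] conjI ballI impI)
    show "D \<subseteq> supp_in V" by fact
    show "bij_betw h D (h ` supp_in V)"
      using inj surj D_sub by (auto simp: bij_betw_def)
    show "k \<in> D" if "k \<in> supp_in V" "l \<in> supp_in V" "(\<lambda>v. k v + l v) \<in> D" for k l
      using up[of k l] that by (auto simp: U_def)
    show "(\<lambda>v. k v + l v) \<in> D" if k: "k \<in> D" and l: "l \<in> supp_in V" and kl: "\<forall>v. 0 < l v \<longrightarrow> K \<le> k v" for k l
    proof (rule ccontr)
      assume "(\<lambda>v. k v + l v) \<notin> D"
      then have "(\<lambda>v. k v + l v) \<in> U"
        using k l D_sub supp_in_add by (auto simp: U_def)
      then obtain u where u: "u \<in> B" "\<And>v. v \<in> V \<Longrightarrow> u v \<le> k v + l v" using B(3) by blast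
      have uk: "u v \<le> k v" for v
      proof (cases "v \<in> V")
        case True
        then show ?thesis
          using u(2)[OF True] K[OF u(1) True] kl[rule_format, of v] by (cases "l v") auto
      next
        case False
        then show ?thesis using u(1) B(1) by (auto simp: U_def supp_in_def)
      qed
      have "(\<lambda>v. k v - u v) \<in> supp_in V"
        using k D_sub by (auto simp: supp_in_def)
      then have "(\<lambda>v. u v + (k v - u v)) \<in> U"
        using u(1) B(1) by (intro up) auto
      then have "k \<in> U" using uk by simp
      then show False using k by (simp add: U_def)
    qed
  qed
qed

definition comb :: "(int ^ 'i) set \<Rightarrow> (int ^ 'i \<Rightarrow> nat) \<Rightarrow> int ^ 'i" where
  "comb V k = (\<Sum>v\<in>V. int (k v) *s v)"

lemma comb_add: "comb V (\<lambda>v. k v + l v) = comb V k + comb V l"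
  by (simp add: comb_def vector_sadd_rdistrib sum.distrib)

lemma comb_nth: "comb V k $ i = (\<Sum>v\<in>V. int (k v) * v $ i)"
  by (simp add: comb_def)

lemma comb_nonneg: "V \<subseteq> nonneg_vecs \<Longrightarrow> comb V k \<in> nonneg_vecs"
  by (auto simp: nonneg_vecs_def comb_nth intro!: sum_nonneg)

lemma comb_subset:
  assumes "finite V" "J \<subseteq> V" "k \<in> supp_in J"
  shows "comb V k = comb J k"
  unfolding comb_def using assms by (intro sum.mono_neutral_right) (auto simp: supp_in_def)

text \<open>
  The minimal nonzero elements generate: if \<open>v \<le> m\<close> for such an element, then \<open>m - v\<close> is
  nonnegative and in \<open>M\<close> because \<open>M\<close> is a group.
\<close>

lemma Gordan_generators:
  fixes M :: "(int ^ 'i) set"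
  assumes M: "subgroup M lattice_group"
  obtains V where "finite V" "V \<subseteq> M \<inter> nonneg_vecs" "comb V ` supp_in V = M \<inter> nonneg_vecs"
proof -
  define A where "A = M \<inter> nonneg_vecs - {0}"
  obtain V where V: "V \<subseteq> A" "finite V" "\<And>m. m \<in> A \<Longrightarrow> \<exists>v\<in>V. \<forall>i\<in>UNIV. nat (v $ i) \<le> nat (m $ i)"
    using Dickson[OF finite_class.finite_UNIV, of A "\<lambda>y i. nat (y $ i)"] by blast
  have gen: "m \<in> comb V ` supp_in V" if "m \<in> M \<inter> nonneg_vecs" for m
    using that
  proof (induction "nat (\<Sum>i\<in>UNIV. m $ i)" arbitrary: m rule: less_induct)
    case less
    show ?case
    proof (cases "m = 0")
      case True
      then show ?thesis
        by (intro image_eqI[of _ _ "\<lambda>_. 0"]) (auto simp: comb_def supp_in_def)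
    next
      case False
      then obtain v where v: "v \<in> V" "\<And>i. nat (v $ i) \<le> nat (m $ i)"
        using V(3)[of m] less.prems by (auto simp: A_def)
      have vA: "v \<in> M" "v \<in> nonneg_vecs" "v \<noteq> 0" using v(1) V(1) by (auto simp: A_def)
      have le: "v $ i \<le> m $ i" for i
        using v(2)[of i] less.prems by (simp add: nonneg_vecs_def nat_le_eq_zle)
      have mv: "m - v \<in> M \<inter> nonneg_vecs"
        using less.prems vA(1) le by (auto simp: nonneg_vecs_def intro: subgroup_diff[OF M])
      obtain i where "v $ i \<noteq> 0" using vA(3) by (auto simp: vec_eq_iff)
      then have "0 < (\<Sum>i\<in>UNIV. v $ i)"
        using vA(2) by (intro sum_pos2[of UNIV i]) (auto simp: nonneg_vecs_def order_less_le)
      then have "nat (\<Sum>i\<in>UNIV. (m - v) $ i) < nat (\<Sum>i\<in>UNIV. m $ i)"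
        using sum_mono[of UNIV "\<lambda>i. v $ i" "\<lambda>i. m $ i"] le by (simp add: sum_subtractf)
      then obtain k where k: "k \<in> supp_in V" "m - v = comb V k"
        using less.hyps[OF _ mv] by blast
      have "comb V (\<lambda>w. if w = v then 1 else 0) = v"
        using v(1) V(2) by (simp add: comb_def if_distrib[of int] if_distrib[of "\<lambda>c. c *s _"] cong: if_cong)
      then have "m = comb V (\<lambda>w. k w + (if w = v then 1 else 0))"
        unfolding comb_add using k(2) by (simp add: algebra_simps)
      moreover have "(\<lambda>w. k w + (if w = v then 1 else 0)) \<in> supp_in V"
        using k(1) v(1) by (auto simp: supp_in_def)
      ultimately show ?thesis by blast
    qed
  qed
  have "comb V k \<in> M \<inter> nonneg_vecs" for k
    using V(1) comb_nonneg[of V k]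
    by (auto simp: A_def comb_def intro!: subgroup_sum[OF M] subgroup_scale[OF M])
  then show thesis
    using that[of V] V gen by (fastforce simp: A_def)
qed

text \<open>
  A real relation yields a nontrivial integral one by approximation.  Its positive and negative parts are two
  different combinations with natural coefficients and the same value.
\<close>

lemma independent_emb:
  fixes J :: "(int ^ 'i) set"
  assumes J: "finite J" and inj: "inj_on (comb J) (supp_in J)"
  shows "independent (emb ` J)"
proof
  assume "dependent (emb ` J)"
  then obtain u w0 where u: "w0 \<in> emb ` J" "u w0 \<noteq> 0" "(\<Sum>w\<in>emb ` J. u w *\<^sub>R w) = 0"
    using dependent_finite[of "emb ` J"] J by auto
  then obtain v0 where v0: "v0 \<in> J" "w0 = emb v0" by blast
  define c where "c v = u (emb v) / u w0" for v
  have c: "(\<Sum>v\<in>J. c v * of_int (v $ i)) = 0" for i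
  proof -
    have "(\<Sum>v\<in>J. u (emb v) *\<^sub>R emb v) $ i = 0"
      using u(3) by (subst (asm) sum.reindex) (auto simp: inj_on_subset[OF inj_emb])
    then have "(\<Sum>v\<in>J. u (emb v) * of_int (v $ i)) = 0" by simp
    then show ?thesis by (simp add: c_def sum_divide_distrib[symmetric])
  qed
  obtain N p where N: "0 < N" and p: "\<And>v. v \<in> J \<Longrightarrow> \<bar>of_int N * c v - of_int (p v)\<bar> < 1"
    "\<And>i. i \<in> (UNIV :: 'i set) \<Longrightarrow>
        \<bar>of_int N * (\<Sum>v\<in>J. c v * of_int (v $ i)) - of_int (\<Sum>v\<in>J. p v * v $ i)\<bar> < 1"
    using Dirichlet_approx_matrix[OF J finite_class.finite_UNIV zero_less_one,
        where c = c and A = "\<lambda>v i. v $ i"] by blast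
  have rel: "(\<Sum>v\<in>J. p v * v $ i) = 0" for i
  proof -
    have "\<bar>real_of_int (\<Sum>v\<in>J. p v * v $ i)\<bar> < 1" using p(2)[of i] c[of i] by simp
    then show ?thesis by linarith
  qed
  have "c v0 = 1" using u(2) v0 by (simp add: c_def)
  then have "p v0 \<noteq> 0" using p(1)[OF v0(1)] N by auto
  define k where "k v = (if v \<in> J then nat (p v) else 0)" for v
  define l where "l v = (if v \<in> J then nat (- p v) else 0)" for v
  have "comb J k - comb J l = 0"
  proof (rule vec_eq_iff[THEN iffD2, rule_format])
    fix i
    have "(comb J k - comb J l) $ i = (\<Sum>v\<in>J. (int (k v) - int (l v)) * v $ i)"
      by (simp add: comb_nth sum_subtractf left_diff_distrib)
    also have "\<dots> = (\<Sum>v\<in>J. p v * v $ i)"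
      by (intro sum.cong) (auto simp: k_def l_def)
    finally show "(comb J k - comb J l) $ i = 0 $ i" by (simp add: rel)
  qed
  then have "k = l"
    using inj by (auto simp: inj_on_def supp_in_def k_def l_def)
  then have "k v0 = l v0" by simp
  then show False using \<open>p v0 \<noteq> 0\<close> v0(1) by (auto simp: k_def l_def)
qed

section \<open>Holomorphy of the series\<close>

lemma pairing_add: "pairing y (s + h) = pairing y s + pairing y h"
  by (simp add: pairing_def sum.distrib algebra_simps)

lemma pairing_scale: "pairing y (c *s h) = c * pairing y h"
  by (simp add: pairing_def sum_distrib_left mult.left_commute)

lemma pairing_scaleR: "pairing y (r *\<^sub>R h) = of_real r * pairing y h"
  by (simp add: pairing_def sum_distrib_left mult.left_commute
      scaleR_conv_of_real[where 'a = complex])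

lemma norm_pairing_le:
  assumes "y \<in> nonneg_vecs"
  shows "norm (pairing y h) \<le> height y * norm h"
proof -
  have "norm (pairing y h) \<le> (\<Sum>i\<in>UNIV. norm (of_int (y $ i) * h $ i))"
    unfolding pairing_def by (rule norm_sum)
  also have "\<dots> \<le> (\<Sum>i\<in>UNIV. real_of_int (y $ i) * norm h)"
    using assms by (intro sum_mono) (auto simp: norm_mult nonneg_vecs_def intro!: mult_mono
        Finite_Cartesian_Product.norm_nth_le)
  finally show ?thesis
    by (simp add: height_def sum_distrib_right)
qed

lemma q_pow_shift:
  assumes "1 < q"
  shows "q_pow q (s + h) y = q_pow q s y * exp (- (of_real (ln (real q)) * pairing y h))"
proof -
  have "of_nat q powr (- pairing y h) = exp (- (of_real (ln (real q)) * pairing y h))"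
    using assms by (simp add: powr_def Ln_of_nat mult.commute)
  then show ?thesis
    by (simp add: q_pow_def pairing_add powr_diff powr_minus divide_inverse)
qed

lemma has_sum_diff:
  fixes f g :: "'a \<Rightarrow> 'b::real_normed_vector"
  assumes "(f has_sum S) A" "(g has_sum T) A"
  shows "((\<lambda>x. f x - g x) has_sum (S - T)) A"
  using has_sum_add[OF assms(1), of "\<lambda>x. - g x" "- T"] assms(2) by (simp add: has_sum_uminus)

text \<open>
  At a point with all real parts at least \<open>3 \<delta>\<close>, the first and second order parts of every term are
  bounded by the terms at \<open>\<delta>\<close>: two factors \<open>E y = q powr (\<delta> * height y)\<close> absorb the
  polynomial growth of the derivatives and the exponential growth of the remainder.  Hence the series may be
  differentiated term by term.
\<close>

lemma holomorphic_L_series: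
  fixes A :: "(int ^ 'i) set"
  assumes q: "1 < q" and A: "A \<subseteq> nonneg_vecs"
    and b: "\<And>\<delta>. 0 < \<delta> \<Longrightarrow> (\<lambda>y. norm (b y) * real q powr (- \<delta> * height y)) summable_on A"
  shows "holomorphic_Cn (\<lambda>s. \<Sum>\<^sub>\<infinity>y\<in>A. b y * q_pow q s y) (tube (Lambda_dual_gt 0))"
  unfolding holomorphic_Cn_def
proof (intro conjI ballI open_tube)
  fix s :: "complex ^ 'i" assume "s \<in> tube (Lambda_dual_gt 0)"
  then obtain \<delta>' where "0 < \<delta>'" "\<And>i. \<delta>' \<le> Re (s $ i)"
    by (rule tube_lower_bound) blast
  define \<delta> where "\<delta> = \<delta>' / 3"
  have \<delta>: "0 < \<delta>" "\<And>i. 3 * \<delta> \<le> Re (s $ i)"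
    using \<open>0 < \<delta>'\<close> \<open>\<And>i. \<delta>' \<le> Re (s $ i)\<close> by (auto simp: \<delta>_def)
  define L where "L = ln (real q)"
  have L: "0 < L" using q by (simp add: L_def)
  define W where "W y = norm (b y) * real q powr (- \<delta> * height y)" for y
  have W: "W summable_on A" "\<And>y. 0 \<le> W y"
    using b[OF \<delta>(1)] unfolding W_def by auto
  define E where "E y = real q powr (\<delta> * height y)" for y :: "int ^ 'i"
  have E_exp: "E y = exp (\<delta> * (L * height y))" for y
    using q by (simp add: E_def powr_def L_def mult_ac)
  have E1: "1 \<le> E y" if "y \<in> A" for y
    using that A height_nonneg[of y] \<delta>(1) L by (auto simp: E_exp)
  have Lin: "L * height y \<le> E y / \<delta>" if "y \<in> A" for y
  proof -
    have "\<delta> * (L * height y) \<le> E y"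
      using exp_ge_add_one_self[of "\<delta> * (L * height y)"] unfolding E_exp by linarith
    then show ?thesis using \<delta>(1) by (simp add: field_simps)
  qed
  have Quad: "(L * height y)\<^sup>2 \<le> 2 / \<delta>\<^sup>2 * E y" if "y \<in> A" for y
  proof -
    have "0 \<le> \<delta> * (L * height y)"
      using that A height_nonneg[of y] \<delta>(1) L by auto
    from exp_lower_Taylor_quadratic[OF this] this
    have "(\<delta> * (L * height y))\<^sup>2 \<le> 2 * E y"
      unfolding E_exp by linarith
    then show ?thesis
      using \<delta>(1) by (simp add: field_simps)
  qed
  have U: "norm (q_pow q s y) * (E y * E y) \<le> real q powr (- \<delta> * height y)" if "y \<in> A" for y
  proof -
    have "norm (q_pow q s y) * (E y * E y) \<le> real q powr (- (3 * \<delta>) * height y) * (E y * E y)"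
      using that A \<delta>(2) q E1[OF that] by (intro mult_right_mono norm_q_pow_le) auto
    also have "\<dots> = real q powr (- \<delta> * height y)"
      by (simp add: E_def powr_add[symmetric] algebra_simps)
    finally show ?thesis .
  qed
  have bU: "norm (b y) * (norm (q_pow q s y) * (E y * E y)) \<le> W y" if "y \<in> A" for y
    unfolding W_def by (intro mult_left_mono U that) auto
  define w where "w h y = - (of_real L * pairing y h)" for h :: "complex ^ 'i" and y
  have w: "norm (w h y) \<le> L * height y * norm h" if "y \<in> A" for h y
    using norm_pairing_le[of y h] that A L by (auto simp: w_def norm_mult mult.assoc)
  define D where "D h = (\<Sum>\<^sub>\<infinity>y\<in>A. b y * q_pow q s y * w h y)" for h
  have D_term: "norm (b y * q_pow q s y * w h y) \<le> W y * (norm h / \<delta>)" if "y \<in> A" for h y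
  proof -
    have "norm (w h y) \<le> (E y * E y) * (norm h / \<delta>)"
    proof -
      have "norm (w h y) \<le> E y / \<delta> * norm h"
        by (rule order_trans[OF w[OF that]]) (intro mult_right_mono Lin that, simp)
      also have "\<dots> = E y * (norm h / \<delta>)" by simp
      also have "\<dots> \<le> (E y * E y) * (norm h / \<delta>)"
        using E1[OF that] \<delta>(1) by (intro mult_right_mono) auto
      finally show ?thesis .
    qed
    then have "norm (b y * q_pow q s y * w h y)
        \<le> norm (b y) * norm (q_pow q s y) * ((E y * E y) * (norm h / \<delta>))"
      unfolding norm_mult by (intro mult_left_mono) auto
    also have "\<dots> = norm (b y) * (norm (q_pow q s y) * (E y * E y)) * (norm h / \<delta>)"
      by (simp add: mult_ac)
    also have "\<dots> \<le> W y * (norm h / \<delta>)"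
      using \<delta>(1) by (intro mult_right_mono bU that) auto
    finally show ?thesis .
  qed
  have D_sum: "(\<lambda>y. norm (b y * q_pow q s y * w h y)) summable_on A" for h
    by (rule summable_on_comparison_test[OF summable_on_cmult_left[OF W(1), of "norm h / \<delta>"]])
       (use D_term in auto)
  note D_has_sum = has_sum_infsum[OF abs_summable_summable[OF D_sum], folded D_def]
  have lin: "bounded_linear D"
  proof (rule bounded_linear_intro)
    show "D (g + h) = D g + D h" for g h
      using has_sum_add[OF D_has_sum D_has_sum, of g h]
      unfolding D_def[of "g + h"] by (intro infsumI) (simp add: w_def pairing_add algebra_simps)
    show "D (r *\<^sub>R h) = r *\<^sub>R D h" for r h
      using has_sum_cmult_right[OF D_has_sum, of "of_real r" h]
      unfolding D_def[of "r *\<^sub>R h"] 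
      by (intro infsumI) (simp add: w_def pairing_scaleR scaleR_conv_of_real[where 'a = complex] mult_ac)
    show "norm (D h) \<le> norm h * (infsum W A / \<delta>)" for h
    proof -
      have "norm (D h) \<le> infsum W A * (norm h / \<delta>)"
        by (rule norm_infsum_le[OF D_has_sum has_sum_cmult_left[OF has_sum_infsum[OF W(1)]]])
           (rule D_term)
      then show ?thesis by (simp add: mult_ac)
    qed
  qed
  have cscale: "D (c *s h) = c * D h" for c h
    using has_sum_cmult_right[OF D_has_sum, of c h]
    unfolding D_def[of "c *s h"] by (intro infsumI) (simp add: w_def pairing_scale mult_ac)
  define F where "F s = (\<Sum>\<^sub>\<infinity>y\<in>A. b y * q_pow q s y)" for s
  have F: "((\<lambda>y. b y * q_pow q s y * exp (w h y)) has_sum F (s + h)) A" if h: "norm h \<le> \<delta>" for h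
  proof -
    have "(\<lambda>y. norm (b y * q_pow q s y * exp (w h y))) summable_on A"
    proof (rule summable_on_comparison_test[OF W(1)])
      fix y assume y: "y \<in> A"
      have "norm (exp (w h y)) \<le> exp (norm (w h y))"
        by (rule norm_exp)
      also have "\<dots> \<le> E y"
      proof -
        have "norm (w h y) \<le> L * height y * \<delta>"
          using w[OF y, of h] h height_nonneg[of y] y A L
          by (smt (verit) mult_left_mono mult_nonneg_nonneg subsetD)
        then show ?thesis by (simp add: E_exp mult_ac)
      qed
      also have "\<dots> \<le> E y * E y" using E1[OF y] by simp
      finally have "norm (b y * q_pow q s y * exp (w h y)) \<le> norm (b y) * norm (q_pow q s y) * (E y * E y)"
        unfolding norm_mult by (intro mult_left_mono) auto
      then show "norm (b y * q_pow q s y * exp (w h y)) \<le> W y"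
        using bU[OF y] by (simp add: mult_ac)
    qed simp
    then show ?thesis
      using has_sum_infsum[OF abs_summable_summable] 
      by (simp add: F_def q_pow_shift[OF q] w_def L_def mult_ac)
  qed
  have F0: "((\<lambda>y. b y * q_pow q s y) has_sum F s) A"
    using F[of 0] \<delta>(1) by (simp add: w_def pairing_def)
  define C where "C = 2 / \<delta>\<^sup>2 * infsum W A"
  have C: "0 \<le> C" using W(2) by (simp add: C_def infsum_nonneg)
  have remainder: "norm (F (s + h) - F s - D h) \<le> C * (norm h)\<^sup>2" if h: "norm h \<le> \<delta>" for h
  proof -
    have "((\<lambda>y. b y * q_pow q s y * exp (w h y) - b y * q_pow q s y - b y * q_pow q s y * w h y)
        has_sum (F (s + h) - F s - D h)) A"
      by (intro has_sum_diff F F0 D_has_sum h)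
    moreover have "((\<lambda>y. W y * (2 / \<delta>\<^sup>2 * (norm h)\<^sup>2)) has_sum (infsum W A * (2 / \<delta>\<^sup>2 * (norm h)\<^sup>2))) A"
      by (intro has_sum_cmult_left has_sum_infsum W)
    moreover have "norm (b y * q_pow q s y * exp (w h y) - b y * q_pow q s y - b y * q_pow q s y * w h y)
        \<le> W y * (2 / \<delta>\<^sup>2 * (norm h)\<^sup>2)" if y: "y \<in> A" for y
    proof -
      have wh: "norm (w h y) \<le> \<delta> * (L * height y)"
        using w[OF y, of h] h height_nonneg[of y] y A L
        by (smt (verit) mult.commute mult_left_mono mult_nonneg_nonneg subsetD)
      have "norm (exp (w h y) - 1 - w h y) \<le> exp (norm (w h y)) * (norm (w h y))\<^sup>2"
        using Taylor_exp_field[of "w h y" 1] by (simp add: power2_eq_square algebra_simps)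
      also have "\<dots> \<le> E y * (L * height y * norm h)\<^sup>2"
        using wh w[OF y, of h] by (intro mult_mono power_mono) (auto simp: E_exp)
      also have "\<dots> \<le> E y * (2 / \<delta>\<^sup>2 * E y * (norm h)\<^sup>2)"
        unfolding power_mult_distrib[of _ "norm h"] using E1[OF y]
        by (intro mult_left_mono mult_right_mono Quad y) auto
      finally have *: "norm (exp (w h y) - 1 - w h y) \<le> (E y * E y) * (2 / \<delta>\<^sup>2 * (norm h)\<^sup>2)"
        by (simp add: mult_ac)
      have "norm (b y * q_pow q s y * exp (w h y) - b y * q_pow q s y - b y * q_pow q s y * w h y)
          = norm (b y) * norm (q_pow q s y) * norm (exp (w h y) - 1 - w h y)"
        unfolding norm_mult[symmetric] by (simp add: algebra_simps)
      also have "\<dots> \<le> norm (b y) * norm (q_pow q s y) * ((E y * E y) * (2 / \<delta>\<^sup>2 * (norm h)\<^sup>2))"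
        by (intro mult_left_mono *) auto
      also have "\<dots> = norm (b y) * (norm (q_pow q s y) * (E y * E y)) * (2 / \<delta>\<^sup>2 * (norm h)\<^sup>2)"
        by (simp add: mult_ac)
      also have "\<dots> \<le> W y * (2 / \<delta>\<^sup>2 * (norm h)\<^sup>2)"
        by (intro mult_right_mono bU y) auto
      finally show ?thesis .
    qed
    ultimately have "norm (F (s + h) - F s - D h) \<le> infsum W A * (2 / \<delta>\<^sup>2 * (norm h)\<^sup>2)"
      by (rule norm_infsum_le)
    then show ?thesis by (simp add: C_def mult_ac)
  qed
  have "(F has_derivative D) (at s)"
    unfolding has_derivative_at_alt
  proof (intro conjI lin allI impI)
    fix e :: real assume e: "0 < e"
    show "\<exists>d>0. \<forall>y. norm (y - s) < d \<longrightarrow> norm (F y - F s - D (y - s)) \<le> e * norm (y - s)"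
    proof (intro exI[of _ "min \<delta> (e / (C + 1))"] conjI allI impI)
      show "0 < min \<delta> (e / (C + 1))" using \<delta>(1) e C by simp
      fix y assume y: "norm (y - s) < min \<delta> (e / (C + 1))"
      then have "norm (y - s) * (C + 1) \<le> e"
        using C by (simp add: pos_less_divide_eq less_imp_le)
      moreover have "norm (y - s) * (C + 1) = C * norm (y - s) + norm (y - s)"
        by (simp add: algebra_simps)
      ultimately have "C * norm (y - s) \<le> e"
        using norm_ge_zero[of "y - s"] by linarith
      then have "C * (norm (y - s))\<^sup>2 \<le> e * norm (y - s)"
        by (simp add: power2_eq_square mult.assoc[symmetric] mult_right_mono)
      then show "norm (F y - F s - D (y - s)) \<le> e * norm (y - s)"
        using remainder[of "y - s"] y by simp
    qed
  qed
  then show "\<exists>D. ((\<lambda>s. \<Sum>\<^sub>\<infinity>y\<in>A. b y * q_pow q s y) has_derivative D) (at s) \<and>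
      (\<forall>c v. D (c *s v) = c * D v)"
    unfolding F_def using cscale by blast
qed

lemma holomorphic_Cn_mult:
  assumes "holomorphic_Cn f S" "holomorphic_Cn g S"
  shows "holomorphic_Cn (\<lambda>s. f s * g s) S"
  unfolding holomorphic_Cn_def
proof (intro conjI ballI)
  show "open S" using assms by (simp add: holomorphic_Cn_def)
  fix s assume "s \<in> S"
  then obtain D D' where "(f has_derivative D) (at s)" "\<forall>c v. D (c *s v) = c * D v"
    "(g has_derivative D') (at s)" "\<forall>c v. D' (c *s v) = c * D' v"
    using assms unfolding holomorphic_Cn_def by blast
  then show "\<exists>D. ((\<lambda>s. f s * g s) has_derivative D) (at s) \<and> (\<forall>c v. D (c *s v) = c * D v)"
    by (intro exI[of _ "\<lambda>h. f s * D' h + D h * g s"] conjI has_derivative_mult)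
       (auto simp: algebra_simps)
qed

section \<open>Simplicial cones and admissible products\<close>

lemma holomorphic_Cn_cong:
  assumes "holomorphic_Cn f S" "\<And>s. s \<in> S \<Longrightarrow> f s = g s"
  shows "holomorphic_Cn g S"
  unfolding holomorphic_Cn_def
proof (intro conjI ballI)
  show S: "open S" using assms(1) by (simp add: holomorphic_Cn_def)
  fix s assume "s \<in> S"
  then obtain D where "(f has_derivative D) (at s)" "\<forall>c v. D (c *s v) = c * D v"
    using assms(1) unfolding holomorphic_Cn_def by blast
  moreover from this(1) S \<open>s \<in> S\<close> assms(2) have "(g has_derivative D) (at s)"
    by (rule has_derivative_transform_within_open)
  ultimately show "\<exists>D. (g has_derivative D) (at s) \<and> (\<forall>c v. D (c *s v) = c * D v)"
    by blast
qed

lemma holomorphic_elem_admissible_0: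
  fixes f :: "complex ^ 'i \<Rightarrow> complex"
  assumes "1 < q" "elem_admissible_0 q f"
  shows "holomorphic_Cn f (tube (Lambda_dual_gt 0))"
proof -
  obtain b \<eta> where \<eta>: "0 < \<eta>"
    and b: "\<And>s. s \<in> tube (Lambda_dual_gt (- \<eta>)) \<Longrightarrow> L_conv UNIV Lambda b (q_pow q s)"
    and f: "\<And>s. s \<in> tube (Lambda_dual_gt 0) \<Longrightarrow> f s = L_fun UNIV Lambda b (q_pow q s)"
    using assms(2) unfolding elem_admissible_0_def by blast
  have "holomorphic_Cn (\<lambda>s. \<Sum>\<^sub>\<infinity>y\<in>nonneg_vecs. b y * q_pow q s y) (tube (Lambda_dual_gt 0))"
  proof (rule holomorphic_L_series[OF assms(1) subset_refl])
    fix \<delta> :: real assume "0 < \<delta>"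
    let ?s = "(\<chi> i. of_real \<delta>) :: complex ^ 'i"
    have "?s \<in> tube (Lambda_dual_gt (- \<eta>))"
      using \<open>0 < \<delta>\<close> \<eta> by (simp add: tube_iff)
    from b[OF this] show "(\<lambda>y. norm (b y) * real q powr (- \<delta> * height y)) summable_on nonneg_vecs"
      by (simp add: L_conv_Lambda norm_mult norm_q_pow height_def sum_distrib_left mult.commute
          sum_negf)
  qed
  then show ?thesis
    by (rule holomorphic_Cn_cong) (simp add: f L_fun_Lambda)
qed

text \<open>
  The coefficient vectors of the lattice points in the relative interior of the cone over \<open>J\<close>.
\<close>

definition pos_in :: "'b set \<Rightarrow> ('b \<Rightarrow> nat) set" where
  "pos_in J = {l. \<forall>v. 0 < l v \<longleftrightarrow> v \<in> J}"

definition simplicial_lattice :: "(int ^ 'i) set \<Rightarrow> (int ^ 'i) set" where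
  "simplicial_lattice J = range (\<lambda>p. \<Sum>v\<in>J. p v *s v)"

lemma mem_simplicial_lattice: "y \<in> simplicial_lattice J \<longleftrightarrow> (\<exists>p. y = (\<Sum>v\<in>J. p v *s v))"
  by (auto simp: simplicial_lattice_def)

lemma independent_embD:
  assumes "finite J" "independent (emb ` J)" "(\<Sum>v\<in>J. u v *\<^sub>R emb v) = 0" "v \<in> J"
  shows "u v = 0"
proof -
  have inj: "inj_on emb J" by (rule inj_on_subset[OF inj_emb subset_UNIV])
  have "(\<Sum>w\<in>emb ` J. u (inv_into J emb w) *\<^sub>R w) = (\<Sum>v\<in>J. u v *\<^sub>R emb v)"
    by (subst sum.reindex[OF inj]) (simp add: inj)
  then have "u (inv_into J emb (emb v)) = 0"
    using assms independentD[of "emb ` J" "emb ` J" "\<lambda>w. u (inv_into J emb w)" "emb v"] by simp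
  then show ?thesis using assms(4) by (simp add: inj)
qed

context
  fixes J :: "(int ^ 'i) set"
  assumes J: "finite J" "J \<subseteq> nonneg_vecs" "independent (emb ` J)"
begin

lemma inj_on_comb: "inj_on (comb J) (pos_in J)"
proof (rule inj_onI, rule ext)
  fix k l v assume kl: "k \<in> pos_in J" "l \<in> pos_in J" "comb J k = comb J l"
  have "(\<Sum>v\<in>J. (real (k v) - real (l v)) *\<^sub>R emb v) = emb (comb J k) - emb (comb J l)"
    by (simp add: comb_def emb_sum emb_scale sum_subtractf scaleR_left_diff_distrib)
  then have "real (k v) - real (l v) = 0" if "v \<in> J"
    using independent_embD[OF J(1,3) _ that, of "\<lambda>v. real (k v) - real (l v)"] kl(3) by simp
  then show "k v = l v"
    using kl(1,2) by (cases "v \<in> J") (simp, metis (mono_tags) pos_in_def mem_Collect_eq neq0_conv)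
qed

lemma simplicial_relint:
  "comb J ` pos_in J = {y \<in> simplicial_lattice J. emb y \<in> rel_interior (convex_cone hull (emb ` J))}"
proof -
  have inj: "inj_on emb J" by (rule inj_on_subset[OF inj_emb subset_UNIV])
  have relint: "rel_interior (convex_cone hull (emb ` J)) =
      {\<Sum>v\<in>J. c (emb v) *\<^sub>R emb v | c. \<forall>v\<in>J. 0 < c (emb v)}"
    using J(1) by (simp add: rel_interior_convex_cone_hull_finite sum.reindex[OF inj])
  show ?thesis
  proof (intro equalityI subsetI)
    fix y assume "y \<in> comb J ` pos_in J"
    then obtain l where l: "l \<in> pos_in J" "y = comb J l" by blast
    have y: "y = (\<Sum>v\<in>J. int (l v) *s v)"
      by (simp add: l comb_def)
    then have emb_y: "emb y = (\<Sum>v\<in>J. (\<lambda>w. real (l (inv_into J emb w))) (emb v) *\<^sub>R emb v)"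
      by (simp add: emb_sum emb_scale inj)
    have pos: "\<forall>v\<in>J. 0 < (\<lambda>w. real (l (inv_into J emb w))) (emb v)"
      using l(1) by (simp add: inj pos_in_def)
    have "y \<in> simplicial_lattice J"
      unfolding y mem_simplicial_lattice by (intro exI[of _ "\<lambda>v. int (l v)"]) (rule refl)
    moreover have "emb y \<in> rel_interior (convex_cone hull (emb ` J))"
      unfolding relint
      by (intro CollectI exI[of _ "\<lambda>w. real (l (inv_into J emb w))"] conjI emb_y pos)
    ultimately show "y \<in> {y \<in> simplicial_lattice J. emb y \<in> rel_interior (convex_cone hull (emb ` J))}"
      by blast
  next
    fix y assume "y \<in> {y \<in> simplicial_lattice J. emb y \<in> rel_interior (convex_cone hull (emb ` J))}"
    then obtain p c where p: "y = (\<Sum>v\<in>J. p v *s v)" and c: "emb y = (\<Sum>v\<in>J. c (emb v) *\<^sub>R emb v)"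
      "\<forall>v\<in>J. 0 < c (emb v)"
      unfolding relint mem_simplicial_lattice by blast
    have "(\<Sum>v\<in>J. (c (emb v) - of_int (p v)) *\<^sub>R emb v) = emb y - emb y"
      unfolding scaleR_left_diff_distrib sum_subtractf c(1)[symmetric]
      by (simp add: p emb_sum emb_scale)
    then have "c (emb v) - of_int (p v) = 0" if "v \<in> J" for v
      using independent_embD[OF J(1,3) _ that, of "\<lambda>v. c (emb v) - of_int (p v)"] by simp
    then have p_pos: "0 < p v" if "v \<in> J" for v
      using c(2) that by fastforce
    have "y = comb J (\<lambda>v. if v \<in> J then nat (p v) else 0)"
      unfolding p comb_def by (intro sum.cong) (auto simp: p_pos less_imp_le)
    moreover have "(\<lambda>v. if v \<in> J then nat (p v) else 0) \<in> pos_in J"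
      using p_pos by (auto simp: pos_in_def)
    ultimately show "y \<in> comb J ` pos_in J" by blast
  qed
qed

lemma simplicial_series:
  "L_fun (simplicial_lattice J) (rel_interior (convex_cone hull (emb ` J))) (\<lambda>_. 1) (q_pow q s) =
     (\<Sum>\<^sub>\<infinity>l\<in>pos_in J. q_pow q s (comb J l))"
  using infsum_reindex[OF inj_on_comb, of "q_pow q s"]
  by (simp add: L_fun_def simplicial_relint[symmetric] o_def)

lemma summable_simplicial_series:
  assumes "1 < q" "s \<in> tube (Lambda_dual_gt 0)"
  shows "(\<lambda>l. norm (q_pow q s (comb J l))) summable_on pos_in J"
proof -
  have "comb J ` pos_in J \<subseteq> nonneg_vecs"
    using comb_nonneg[OF J(2)] by blast
  from summable_on_subset_banach[OF summable_on_q_pow[OF assms] this] show ?thesis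
    using summable_on_reindex[OF inj_on_comb, of "\<lambda>y. norm (q_pow q s y)"] by (simp add: o_def)
qed

text \<open>
  For \<open>r = 0\<close> there are no generators and the second factor is the single term \<open>q_pow q s 0 = 1\<close>.
\<close>

lemma elem_admissible_simplicial:
  assumes q: "1 < q" and r: "card J \<le> r" and g: "elem_admissible_0 q g"
  shows "elem_admissible q r (\<lambda>s. g s * (\<Sum>\<^sub>\<infinity>l\<in>pos_in J. q_pow q s (comb J l)))"
proof (cases "r = 0")
  case True
  then have "J = {}" using r J(1) by simp
  then have "pos_in J = {\<lambda>_. 0}" by (auto simp: pos_in_def)
  then show ?thesis
    using g q True \<open>J = {}\<close> by (simp add: elem_admissible_def comb_def)
next
  case False
  let ?C = "convex_cone hull (emb ` J)"
  let ?A = "comb J ` pos_in J"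
  have sub: "?C \<subseteq> Lambda"
    using J(2) emb_mem_Lambda by (intro hull_minimal) (auto simp: Lambda_def convex_cone_convex_cone_hull)
  have "dim ?C \<le> card (emb ` J)"
  proof (rule dim_le_card)
    show "?C \<subseteq> span (emb ` J)"
      by (intro hull_minimal) (auto simp: convex_cone_iff span_base span_zero span_add span_scale)
  qed (use J(1) in simp)
  also have "\<dots> \<le> r" using card_image_le[OF J(1)] r by (rule order_trans)
  finally have dim: "dim ?C \<le> r" .
  have A: "?A \<subseteq> nonneg_vecs"
    using comb_nonneg[OF J(2)] by blast
  have "holomorphic_Cn (\<lambda>s. \<Sum>\<^sub>\<infinity>y\<in>?A. 1 * q_pow q s y) (tube (Lambda_dual_gt 0))"
    using summable_on_subset_banach[OF summable_powr_height[OF q] A]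
    by (intro holomorphic_L_series[OF q A]) simp
  then have "holomorphic_Cn (\<lambda>s. \<Sum>\<^sub>\<infinity>l\<in>pos_in J. q_pow q s (comb J l)) (tube (Lambda_dual_gt 0))"
    by (simp add: infsum_reindex[OF inj_on_comb] o_def)
  moreover have "subgroup (simplicial_lattice J) lattice_group"
    unfolding subgroup_lattice_group
  proof (intro conjI ballI)
    show "0 \<in> simplicial_lattice J"
      unfolding mem_simplicial_lattice by (intro exI[of _ "\<lambda>_. 0"]) simp
    show "x + y \<in> simplicial_lattice J" if xy: "x \<in> simplicial_lattice J" "y \<in> simplicial_lattice J" for x y
    proof -
      obtain p p' where "x = (\<Sum>v\<in>J. p v *s v)" "y = (\<Sum>v\<in>J. p' v *s v)"
        using xy by (auto simp: mem_simplicial_lattice)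
      then have "x + y = (\<Sum>v\<in>J. (p v + p' v) *s v)"
        by (simp add: vector_sadd_rdistrib sum.distrib)
      then show ?thesis unfolding mem_simplicial_lattice by (rule exI[of _ "\<lambda>v. p v + p' v"])
    qed
    show "- x \<in> simplicial_lattice J" if xy: "x \<in> simplicial_lattice J" for x
    proof -
      obtain p where "x = (\<Sum>v\<in>J. p v *s v)"
        using xy by (auto simp: mem_simplicial_lattice)
      then have "- x = (\<Sum>v\<in>J. (- p v) *s v)"
        by (simp add: vec_eq_iff sum_negf)
      then show ?thesis unfolding mem_simplicial_lattice by (rule exI[of _ "\<lambda>v. - p v"])
    qed
  qed
  moreover have "rational_cone ?C"
    using J(1) by (auto simp: rational_cone_def)
  ultimately show ?thesis
    using False g sub dim holomorphic_Cn_mult[OF holomorphic_elem_admissible_0[OF q g]] simplicial_series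
    unfolding elem_admissible_def by (auto intro!: exI[of _ g] exI[of _ ?C] exI[of _ "simplicial_lattice J"])
qed

end

lemma independent_card_le_rk:
  assumes "J \<subseteq> M" "independent (emb ` J)"
  shows "card J \<le> rk M"
proof -
  have "card (emb ` J) = card J"
    by (rule card_image[OF inj_on_subset[OF inj_emb subset_UNIV]])
  moreover have "emb ` J \<subseteq> real_span M"
    using assms(1) by (auto simp: real_span_def intro: span_base)
  ultimately show ?thesis
    using independent_card_le_dim[of "emb ` J" "real_span M"] assms(2) by (simp add: rk_def)
qed

lemma rk_pos:
  assumes "m \<in> M" "\<And>i. 0 < m $ i"
  shows "1 \<le> rk M"
proof -
  have "emb m \<noteq> 0"
    using assms(2) by (force simp: vec_eq_iff)
  then have "independent (emb ` {m})" by simp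
  with independent_card_le_rk[of "{m}" M] assms(1) show ?thesis by simp
qed

text \<open>
  Otherwise a coordinate would vanish on all of \<open>M\<^sub>R\<close>, but no coordinate of \<open>m\<close> is zero.
\<close>

lemma basis_meets_every_coordinate:
  assumes m: "m \<in> M" "\<And>i. 0 < m $ i"
    and J: "finite J" "J \<subseteq> M" "independent (emb ` J)" "card J = rk M"
  obtains v where "v \<in> J" "v $ i \<noteq> 0"
proof -
  have "\<exists>v\<in>J. v $ i \<noteq> 0"
  proof (rule ccontr)
    assume "\<not> ?thesis"
    then have zero: "emb ` J \<subseteq> {w. w $ i = 0}" by auto
    have "card (emb ` J) = card J"
      by (rule card_image[OF inj_on_subset[OF inj_emb subset_UNIV]])
    then have "real_span M \<subseteq> span (emb ` J)"
      using J by (intro card_ge_dim_independent) (auto simp: rk_def real_span_def intro: span_base)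
    also have "\<dots> \<subseteq> {w. w $ i = 0}"
      using zero by (rule span_minimal) (auto simp: subspace_def)
    finally have "real_span M \<subseteq> {w. w $ i = 0}" .
    moreover have "emb m \<in> real_span M"
      using m(1) by (simp add: real_span_def span_base)
    ultimately have "emb m \<in> {w. w $ i = 0}" by (rule subsetD)
    then show False using m(2)[of i] by simp
  qed
  then show thesis using that by blast
qed

section \<open>The Haar integral\<close>

lemma sums_infsum_countable:
  fixes h :: "'b::countable \<Rightarrow> 'c::banach"
  assumes "h summable_on S"
  shows "(\<lambda>n. if n \<in> to_nat ` S then h (from_nat n) else 0) sums (\<Sum>\<^sub>\<infinity>p\<in>S. h p)"
proof -
  have "bij_betw to_nat S (to_nat ` S)"
    by (simp add: bij_betw_def inj_on_subset[OF inj_to_nat])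
  moreover have "((\<lambda>p. h (from_nat (to_nat p))) has_sum (\<Sum>\<^sub>\<infinity>p\<in>S. h p)) S"
    using assms by simp
  ultimately have "((\<lambda>n. h (from_nat n)) has_sum (\<Sum>\<^sub>\<infinity>p\<in>S. h p)) (to_nat ` S)"
    by (rule has_sum_reindex_bij_betw[of _ _ _ "\<lambda>n. h (from_nat n)", THEN iffD1])
  then have "((\<lambda>n. if n \<in> to_nat ` S then h (from_nat n) else 0) has_sum (\<Sum>\<^sub>\<infinity>p\<in>S. h p)) UNIV"
    by (rule has_sum_cong_neutral[THEN iffD1, rotated -1]) auto
  then show ?thesis by (rule has_sum_imp_sums)
qed

lemma (in prob_space) integral_infsum:
  fixes f :: "'b::countable \<Rightarrow> 'a \<Rightarrow> complex"
  assumes meas: "\<And>p. p \<in> S \<Longrightarrow> f p \<in> borel_measurable M"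
    and bound: "\<And>p z. p \<in> S \<Longrightarrow> z \<in> space M \<Longrightarrow> norm (f p z) \<le> c p"
    and c: "c summable_on S"
  shows "(\<integral>z. (\<Sum>\<^sub>\<infinity>p\<in>S. f p z) \<partial>M) = (\<Sum>\<^sub>\<infinity>p\<in>S. \<integral>z. f p z \<partial>M)"
proof -
  define g where "g n z = (if n \<in> to_nat ` S then f (from_nat n) z else 0)" for n z
  define c' where "c' n = (if n \<in> to_nat ` S then c (from_nat n) else 0)" for n
  have c': "summable c'"
    using sums_infsum_countable[OF c] unfolding c'_def by (rule sums_summable)
  have gc: "norm (g n z) \<le> c' n" if "z \<in> space M" for n z
    using bound that by (auto simp: g_def c'_def)
  have int: "integrable M (g n)" for n
  proof (rule integrable_const_bound)
    show "AE z in M. norm (g n z) \<le> c' n"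
      using gc by auto
    show "g n \<in> borel_measurable M"
      using meas unfolding g_def by (cases "n \<in> to_nat ` S") auto
  qed
  have norm_int: "(\<integral>z. norm (g n z) \<partial>M) \<le> c' n" for n
  proof -
    have "(\<integral>z. norm (g n z) \<partial>M) \<le> (\<integral>z. c' n \<partial>M)"
      using int gc by (intro integral_mono) auto
    then show ?thesis by (simp add: prob_space)
  qed
  have inner: "(\<Sum>\<^sub>\<infinity>p\<in>S. f p z) = (\<Sum>n. g n z)" if "z \<in> space M" for z
  proof -
    have "(\<lambda>p. f p z) summable_on S"
      by (rule abs_summable_summable, rule summable_on_comparison_test[OF c]) (use bound that in auto)
    from sums_infsum_countable[OF this] show ?thesis
      unfolding g_def by (rule sums_unique)
  qed
  have outer: "(\<Sum>\<^sub>\<infinity>p\<in>S. \<integral>z. f p z \<partial>M) = (\<Sum>n. \<integral>z. g n z \<partial>M)"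
  proof -
    have "norm (\<integral>z. f p z \<partial>M) \<le> c p" if "p \<in> S" for p
    proof -
      have "(\<integral>z. f p z \<partial>M) = (\<integral>z. g (to_nat p) z \<partial>M)" "c p = c' (to_nat p)"
        using that by (auto simp: g_def c'_def)
      then show ?thesis
        using order_trans[OF integral_norm_bound[of M "g (to_nat p)"] norm_int[of "to_nat p"]]
        by simp
    qed
    then have "(\<lambda>p. \<integral>z. f p z \<partial>M) summable_on S"
      by (rule abs_summable_summable[OF summable_on_comparison_test[OF c]]) auto
    then have "(\<lambda>n. if n \<in> to_nat ` S then \<integral>z. f (from_nat n) z \<partial>M else 0) sums
        (\<Sum>\<^sub>\<infinity>p\<in>S. \<integral>z. f p z \<partial>M)"
      by (rule sums_infsum_countable)
    moreover have "(\<lambda>n. if n \<in> to_nat ` S then \<integral>z. f (from_nat n) z \<partial>M else 0) = (\<lambda>n. \<integral>z. g n z \<partial>M)"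
      by (auto simp: g_def fun_eq_iff)
    ultimately show ?thesis
      by (simp add: sums_iff)
  qed
  have "(\<integral>z. (\<Sum>\<^sub>\<infinity>p\<in>S. f p z) \<partial>M) = (\<integral>z. (\<Sum>n. g n z) \<partial>M)"
    by (intro Bochner_Integration.integral_cong refl inner)
  also have "\<dots> = (\<Sum>n. \<integral>z. g n z \<partial>M)"
  proof (rule integral_suminf[OF int])
    show "AE z in M. summable (\<lambda>n. norm (g n z))"
      using gc by (intro AE_I2 summable_comparison_test'[OF c', of 0]) auto
    show "summable (\<lambda>n. \<integral>z. norm (g n z) \<partial>M)"
      using norm_int by (intro summable_comparison_test'[OF c', of 0]) auto
  qed
  finally show ?thesis using outer by simp
qed

context
  fixes M :: "(int ^ 'i) set" and \<mu> :: "((int ^ 'i) set \<Rightarrow> complex) measure"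
  assumes M: "subgroup M lattice_group" and haar: "haar_prob (lattice_group Mod M) \<mu>"
begin

lemma space_haar: "space \<mu> = dual_U (lattice_group Mod M)"
  using haar sets_eq_imp_space_eq[of \<mu> "restrict_space borel (dual_U (lattice_group Mod M))"]
  by (simp add: haar_prob_def space_restrict_space)

lemma prob_space_haar: "prob_space \<mu>"
  using haar by (intro prob_spaceI) (simp add: haar_prob_def)

lemma measurable_haar:
  assumes "f \<in> borel_measurable borel" shows "f \<in> borel_measurable \<mu>"
proof -
  have "f \<in> borel_measurable (restrict_space borel (dual_U (lattice_group Mod M)))"
    using assms by (rule measurable_restrict_space1)
  then show ?thesis
    using haar measurable_cong_sets[of \<mu> _ borel borel] by (metis haar_prob_def)
qed

lemma measurable_j_dual: "(\<lambda>z. j_dual M z y) \<in> borel_measurable \<mu>"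
  unfolding j_dual_def comp_def
  by (intro measurable_haar borel_measurable_continuous_onI continuous_on_product_coordinates)

lemma dual_U_iff:
  "z \<in> dual_U (lattice_group Mod M) \<longleftrightarrow> z \<in> extensional (carrier (lattice_group Mod M)) \<and>
     (\<forall>y. norm (j_dual M z y) = 1) \<and> (\<forall>x y. j_dual M z (x + y) = j_dual M z x * j_dual M z y)"
  by (auto simp: dual_U_def hom_def carrier_Mod[OF M] Mod_mult[OF M] circle_group_def j_dual_def
      simp del: mult_FactGroup)

lemma j_dual_one:
  assumes "z \<in> dual_U (lattice_group Mod M)" "y \<in> M"
  shows "j_dual M z y = 1"
proof -
  have "j_dual M z (0 + 0) = j_dual M z 0 * j_dual M z 0" "norm (j_dual M z 0) = 1"
    using assms(1) dual_U_iff by blast+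
  then have "j_dual M z 0 = 1" by auto
  moreover have "quot_map M y = quot_map M 0"
    using assms(2) by (simp add: quot_map_eq_iff[OF M])
  ultimately show ?thesis by (simp add: j_dual_def)
qed

text \<open>
  The component \<open>t\<close> of \<open>y\<close> orthogonal to \<open>M\<^sub>R\<close> is nonzero by saturation of \<open>M\<close>;
  the character \<open>x \<mapsto> cis (\<pi> \<langle>t, x\<rangle> / \<langle>t, t\<rangle>)\<close> is trivial on \<open>M\<close> and
  takes the value \<open>-1\<close> at \<open>y\<close>.
\<close>

lemma separating_character:
  assumes "torsion_free (lattice_group Mod M)" "y \<notin> M"
  obtains w where "w \<in> dual_U (lattice_group Mod M)" "j_dual M w y \<noteq> 1"
proof -
  have "emb y \<notin> real_span M"
    using real_span_Int_lattice[OF M assms(1)] assms(2) by blast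
  obtain v t where v: "v \<in> real_span M" and t: "\<And>u. u \<in> real_span M \<Longrightarrow> orthogonal t u"
    and "emb y = v + t"
    using orthogonal_subspace_decomp_exists[of "emb ` M" "emb y"] unfolding real_span_def by metis
  have "t \<noteq> 0" using v \<open>emb y = v + t\<close> \<open>emb y \<notin> real_span M\<close> by auto
  have ty: "t \<bullet> emb y = t \<bullet> t"
    using t[OF v] by (simp add: \<open>emb y = v + t\<close> inner_add_right orthogonal_def)
  define h where "h x = cis (pi * (t \<bullet> emb x) / (t \<bullet> t))" for x
  obtain w where w: "w \<in> hom (lattice_group Mod M) circle_group" "\<And>y. w (quot_map M y) = h y"
    "w \<in> extensional (carrier (lattice_group Mod M))"
  proof (rule hom_Mod_lift[OF M, of h circle_group])
    show "h x \<in> carrier circle_group" for x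
      by (simp add: h_def circle_group_def)
    show "h (x + y) = h x \<otimes>\<^bsub>circle_group\<^esub> h y" for x y
      by (simp add: h_def circle_group_def cis_mult emb_add inner_add_right distrib_left add_divide_distrib)
    show "h x = h y" if "x - y \<in> M" for x y
    proof -
      have "emb (x - y) \<in> real_span M"
        using that by (simp add: real_span_def span_base)
      then have "t \<bullet> emb x = t \<bullet> emb y"
        using t by (fastforce simp: orthogonal_def emb_diff inner_diff_right)
      then show ?thesis by (simp add: h_def)
    qed
  qed blast
  have "j_dual M w y = -1"
    using \<open>t \<noteq> 0\<close> by (simp add: j_dual_def w h_def ty)
  then show thesis
    using that[of w] w by (simp add: dual_U_def)
qed

text \<open>
  Substituting the translate of \<open>z\<close> by \<open>w\<close>.  The measure is invariant under images of translations;
  preimages are needed for the substitution, and they are images under the inverse translation.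
\<close>

lemma integral_translate:
  assumes w: "w \<in> dual_U (lattice_group Mod M)"
  shows "(\<integral>z. j_dual M z y \<partial>\<mu>) = j_dual M w y * (\<integral>z. j_dual M z y \<partial>\<mu>)"
proof -
  define G where "G = (lattice_group :: (int ^ 'i) monoid) Mod M"
  define T where "T v = (\<lambda>z. \<lambda>x\<in>carrier G. v x * z x)" for v :: "(int ^ 'i) set \<Rightarrow> complex"
  define w' where "w' = (\<lambda>x\<in>carrier G. cnj (w x))"
  have j_T: "j_dual M (T v z) x = j_dual M v x * j_dual M z x" for v z x
    by (simp add: T_def j_dual_def G_def carrier_Mod[OF M])
  have j_w': "j_dual M w' x = cnj (j_dual M w x)" for x
    by (simp add: w'_def j_dual_def G_def carrier_Mod[OF M])
  have w': "w' \<in> dual_U G"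
    using w unfolding G_def dual_U_iff j_w' by (auto simp: w'_def G_def)
  have T_dual: "T v z \<in> dual_U G" if "v \<in> dual_U G" "z \<in> dual_U G" for v z
    using that unfolding G_def dual_U_iff j_T by (auto simp: T_def G_def norm_mult)
  have unit: "w x * cnj (w x) = 1" if "x \<in> carrier G" for x
    using that w unfolding dual_U_iff 
    by (auto simp: G_def carrier_Mod[OF M] j_dual_def complex_norm_square[symmetric])
  have inv: "T w' (T w z) = z" "T w (T w' z) = z" if "z \<in> dual_U G" for z
    using that unit
    by (auto simp: T_def w'_def fun_eq_iff restrict_def dual_U_def extensional_def mult.assoc[symmetric]
        mult.commute[of "cnj _"])
  have cont: "continuous_on UNIV (T v)" for v
    unfolding T_def restrict_def
  proof (rule continuous_on_coordinatewise_then_product)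
    show "continuous_on UNIV (\<lambda>z. if x \<in> carrier G then v x * z x else undefined)" for x
      by (cases "x \<in> carrier G") (auto intro!: continuous_intros continuous_on_product_coordinates)
  qed
  have "T w \<in> restrict_space borel (dual_U G) \<rightarrow>\<^sub>M restrict_space borel (dual_U G)"
    using T_dual w by (intro measurable_restrict_space3 borel_measurable_continuous_onI cont) (auto simp: G_def)
  moreover have sets: "sets \<mu> = sets (restrict_space borel (dual_U G))"
    using haar by (simp add: haar_prob_def G_def)
  ultimately have meas: "T w \<in> \<mu> \<rightarrow>\<^sub>M \<mu>"
    using measurable_cong_sets[OF sets sets] by blast
  have "distr \<mu> \<mu> (T w) = \<mu>"
  proof (rule measure_eqI)
    fix A assume "A \<in> sets (distr \<mu> \<mu> (T w))"
    then have A: "A \<in> sets \<mu>" by simp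
    have "T w -` A \<inter> space \<mu> = T w' ` A"
    proof (intro equalityI subsetI)
      fix z assume "z \<in> T w -` A \<inter> space \<mu>"
      then show "z \<in> T w' ` A"
        using inv(1)[of z] by (force simp: space_haar G_def)
    next
      fix z assume "z \<in> T w' ` A"
      then obtain u where u: "u \<in> A" "z = T w' u" by blast
      then have "u \<in> dual_U G"
        using sets.sets_into_space[OF A] by (auto simp: space_haar G_def)
      then show "z \<in> T w -` A \<inter> space \<mu>"
        using u inv(2) T_dual[OF w'] by (simp add: space_haar G_def)
    qed
    then have "emeasure (distr \<mu> \<mu> (T w)) A = emeasure \<mu> (T w' ` A)"
      by (simp add: emeasure_distr[OF meas A])
    also have "\<dots> = emeasure \<mu> A"
      using haar w' A unfolding haar_prob_def T_def G_def by blast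
    finally show "emeasure (distr \<mu> \<mu> (T w)) A = emeasure \<mu> A" .
  qed simp
  then have "(\<integral>z. j_dual M z y \<partial>\<mu>) = (\<integral>z. j_dual M (T w z) y \<partial>\<mu>)"
    using integral_distr[OF meas measurable_j_dual[of y]] by simp
  then show ?thesis by (simp add: j_T)
qed

lemma integral_j_dual:
  assumes "torsion_free (lattice_group Mod M)"
  shows "(\<integral>z. j_dual M z y \<partial>\<mu>) = (if y \<in> M then 1 else 0)"
proof (cases "y \<in> M")
  case True
  interpret prob_space \<mu> by (rule prob_space_haar)
  have "(\<integral>z. j_dual M z y \<partial>\<mu>) = (\<integral>z. 1 \<partial>\<mu>)"
    using True by (intro Bochner_Integration.integral_cong) (auto simp: space_haar j_dual_one)
  then show ?thesis using True by (simp add: prob_space)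
next
  case False
  obtain w where "w \<in> dual_U (lattice_group Mod M)" "j_dual M w y \<noteq> 1"
    using separating_character[OF assms False] .
  then show ?thesis
    using integral_translate[of w y] False by simp
qed

text \<open>
  Absolute convergence at every character of modulus one, with a bound that does not depend on the character,
  allows integration term by term; \<open>m\<close> is the sum of the exponents coming from the two factors.
\<close>

lemma f1_eq_sum:
  assumes "torsion_free (lattice_group Mod M)" "1 < q" "s \<in> tube (Lambda_dual_gt 0)"
    and a: "L_conv UNIV Lambda a (q_pow q s)"
  shows "f1 q M \<mu> a s = (\<Sum>\<^sub>\<infinity>(x, m)\<in>{(x, m). x \<in> nonneg_vecs \<and> m \<in> M \<and> m - x \<in> nonneg_vecs}. a x * q_pow q s m)"
proof -
  interpret prob_space \<mu> by (rule prob_space_haar)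
  let ?N = "nonneg_vecs :: (int ^ 'i) set"
  let ?f = "\<lambda>p z. a (fst p) * q_pow q s (fst p + snd p) * j_dual M z (fst p + snd p)"
  let ?c = "\<lambda>p. norm (a (fst p) * q_pow q s (fst p) * q_pow q s (snd p))"
  have sa: "(\<lambda>x. norm (a x * q_pow q s x)) summable_on ?N"
    using a by (simp add: L_conv_Lambda)
  have s1: "(\<lambda>x. norm (q_pow q s x)) summable_on ?N"
    by (rule summable_on_q_pow[OF assms(2,3)])
  have c: "?c summable_on ?N \<times> ?N"
    using has_sum_times(2)[OF sa s1] by (simp add: case_prod_unfold)
  have bound: "norm (?f p z) \<le> ?c p" if "z \<in> space \<mu>" for p z
    using that by (simp add: space_haar dual_U_iff norm_mult q_pow_add)
  have integrand: "L_fun UNIV Lambda a (\<lambda>y. j_dual M z y * q_pow q s y) *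
      L_fun UNIV Lambda (\<lambda>_. 1) (\<lambda>y. j_dual M z y * q_pow q s y) = (\<Sum>\<^sub>\<infinity>p\<in>?N \<times> ?N. ?f p z)"
    if "z \<in> space \<mu>" for z
  proof -
    have z: "norm (j_dual M z y) = 1" "j_dual M z (x + y) = j_dual M z x * j_dual M z y" for x y
      using that by (auto simp: space_haar dual_U_iff)
    have "(\<lambda>x. norm (a x * (j_dual M z x * q_pow q s x))) summable_on ?N"
      "(\<lambda>x. norm (1 * (j_dual M z x * q_pow q s x))) summable_on ?N"
      using sa s1 by (simp_all add: norm_mult z)
    from infsumI[OF has_sum_times(1)[OF this]] show ?thesis
      by (simp add: L_fun_Lambda case_prod_unfold z q_pow_add mult_ac)
  qed
  have "f1 q M \<mu> a s = (\<integral>z. (\<Sum>\<^sub>\<infinity>p\<in>?N \<times> ?N. ?f p z) \<partial>\<mu>)"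
    unfolding f1_def by (intro Bochner_Integration.integral_cong refl integrand)
  also have "\<dots> = (\<Sum>\<^sub>\<infinity>p\<in>?N \<times> ?N. \<integral>z. ?f p z \<partial>\<mu>)"
    using c bound by (intro integral_infsum[where c = ?c] borel_measurable_times measurable_j_dual) auto
  also have "\<dots> = (\<Sum>\<^sub>\<infinity>p\<in>?N \<times> ?N. a (fst p) * q_pow q s (fst p + snd p) * (if fst p + snd p \<in> M then 1 else 0))"
    by (simp add: integral_j_dual[OF assms(1)])
  also have "\<dots> = (\<Sum>\<^sub>\<infinity>p\<in>{p \<in> ?N \<times> ?N. fst p + snd p \<in> M}. a (fst p) * q_pow q s (fst p + snd p))"
    by (rule infsum_cong_neutral) auto
  also have "\<dots> = (\<Sum>\<^sub>\<infinity>(x, m)\<in>{(x, m). x \<in> ?N \<and> m \<in> M \<and> m - x \<in> ?N}. a x * q_pow q s m)"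
    by (rule infsum_reindex_bij_witness[where i = "\<lambda>(x, m). (x, m - x)" and j = "\<lambda>(x, y). (x, x + y)"]) auto
  finally show ?thesis .
qed

end

section \<open>Decomposition of the difference\<close>

text \<open>
  The sum over the pairs with \<open>x \<le> m\<close> false is split according to which coefficients of the normal
  form \<open>k\<close> of \<open>m\<close> exceed the bound \<open>K x\<close>.  A pair \<open>(x, k)\<close> with large set \<open>J\<close> (in
  \<open>X J\<close>) corresponds to its truncation (in \<open>T J\<close>) and its excess, which has support \<open>J\<close>.
\<close>

lemma deficient_series_admissible:
  fixes M :: "(int ^ 'i) set" and a :: "int ^ 'i \<Rightarrow> complex"
  assumes M: "subgroup M lattice_group" and q: "1 < q"
    and m0: "m0 \<in> M" "\<And>i. 0 < m0 $ i"
    and \<theta>: "0 < \<theta>" and a: "(\<lambda>x. norm (a x) * real q powr (\<theta> * height x)) summable_on nonneg_vecs"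
  shows "admissible q (1 - int (rk M))
    (\<lambda>s. \<Sum>\<^sub>\<infinity>(x, m)\<in>{(x, m). x \<in> nonneg_vecs \<and> m \<in> M \<inter> nonneg_vecs \<and> m - x \<notin> nonneg_vecs}.
      a x * q_pow q s m)"
proof -
  obtain V where V: "finite V" "V \<subseteq> M \<inter> nonneg_vecs" "comb V ` supp_in V = M \<inter> nonneg_vecs"
    using Gordan_generators[OF M] by blast
  obtain D and K0 :: nat where D: "D \<subseteq> supp_in V" "bij_betw (comb V) D (M \<inter> nonneg_vecs)"
    and D': "\<forall>k\<in>supp_in V. \<forall>l\<in>supp_in V. (\<lambda>v. k v + l v) \<in> D \<longrightarrow> k \<in> D"
      "\<forall>k\<in>D. \<forall>l\<in>supp_in V. (\<forall>v. 0 < l v \<longrightarrow> K0 \<le> k v) \<longrightarrow> (\<lambda>v. k v + l v) \<in> D"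
    using normal_forms[OF V(1), of "comb V", OF comb_add] unfolding V(3) by blast
  have down: "k \<in> D" if "k \<in> supp_in V" "l \<in> supp_in V" "(\<lambda>v. k v + l v) \<in> D" for k l
    using that D'(1) by blast
  have stable: "(\<lambda>v. k v + l v) \<in> D"
    if "k \<in> D" "l \<in> supp_in V" "\<And>v. 0 < l v \<Longrightarrow> K0 \<le> k v" for k l
    using that D'(2) by blast
  have nonneg: "comb V k \<in> nonneg_vecs" for k
    using V(2) by (intro comb_nonneg) auto
  \<comment> \<open>\<open>K0\<close> makes the normal forms stable beyond \<open>K x\<close>; the other summand makes a coordinate that
      involves a generator with coefficient \<open>K x\<close> at least as large as that of \<open>x\<close>\<close>
  define K where "K x = K0 + nat (\<Sum>i\<in>UNIV. x $ i)" for x :: "int ^ 'i"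
  have K0: "K0 \<le> K x" for x by (simp add: K_def)
  have K_coord: "x $ i \<le> int (K x)" if "x \<in> nonneg_vecs" for x i
  proof -
    have "x $ i \<le> (\<Sum>i\<in>UNIV. x $ i)"
      using that by (intro member_le_sum) (auto simp: nonneg_vecs_def)
    then show ?thesis by (simp add: K_def)
  qed
  have K_height: "real (K x) = real K0 + height x" if "x \<in> nonneg_vecs" for x
    using that by (simp add: K_def height_def nonneg_vecs_def sum_nonneg)
  define X where "X J = {(x, k). x \<in> nonneg_vecs \<and> k \<in> D \<and> comb V k - x \<notin> nonneg_vecs \<and>
    {v \<in> V. K x < k v} = J}" for J
  define T where "T J = {(x, k). x \<in> nonneg_vecs \<and> k \<in> D \<and> comb V k - x \<notin> nonneg_vecs \<and>
    (\<forall>v\<in>V. k v \<le> K x) \<and> (\<forall>v\<in>J. k v = K x)}" for J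

  have pos_supp: "l \<in> supp_in V" if "J \<subseteq> V" "l \<in> pos_in J" for J l
    using that by (auto simp: pos_in_def supp_in_def)
  have extend: "(\<lambda>v. k v + l v) \<in> D"
    if "(x, k) \<in> T J" "J \<subseteq> V" "l \<in> supp_in J" for x k l J
  proof (rule stable)
    show "k \<in> D" using that(1) by (auto simp: T_def)
    show "l \<in> supp_in V" using that(2,3) by (auto simp: supp_in_def)
    fix v assume "0 < l v"
    then have "v \<in> J" using that(3) by (auto simp: supp_in_def)
    then show "K0 \<le> k v" using that(1) K0[of x] by (auto simp: T_def)
  qed
  \<comment> \<open>a coordinate in which \<open>comb V k\<close> is smaller than \<open>x\<close> involves no generator in \<open>J\<close>, so the
      excess does not change it\<close>
  have far: "comb V (\<lambda>v. k v + l v) - x \<notin> nonneg_vecs"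
    if T: "(x, k) \<in> T J" and "J \<subseteq> V" "l \<in> supp_in J" for x k l J
  proof -
    obtain i where i: "comb V k $ i < x $ i"
      using T by (auto simp: T_def nonneg_vecs_def not_le)
    have "v $ i = 0" if "v \<in> J" for v
    proof (rule ccontr)
      assume "v $ i \<noteq> 0"
      moreover have "v \<in> nonneg_vecs"
        using \<open>v \<in> J\<close> \<open>J \<subseteq> V\<close> V(2) by blast
      then have "0 \<le> v $ i" by (simp add: nonneg_vecs_def)
      ultimately have "1 \<le> v $ i" by linarith
      then have "int (K x) \<le> int (k v) * v $ i"
        using T \<open>v \<in> J\<close> mult_left_mono[of 1 "v $ i" "int (K x)"] by (simp add: T_def)
      also have "\<dots> \<le> comb V k $ i"
        unfolding comb_nth using \<open>v \<in> J\<close> \<open>J \<subseteq> V\<close> V(1,2)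
        by (intro member_le_sum) (auto simp: nonneg_vecs_def)
      finally show False
        using i K_coord[of x i] T by (simp add: T_def)
    qed
    then have "comb V l $ i = 0"
      unfolding comb_subset[OF V(1) \<open>J \<subseteq> V\<close> \<open>l \<in> supp_in J\<close>] by (simp add: comb_nth)
    then show ?thesis
      using i by (auto simp: comb_add nonneg_vecs_def not_le intro!: exI[of _ i])
  qed
  have bij: "bij_betw (\<lambda>((x, k), l). (x, \<lambda>v. k v + l v)) (T J \<times> pos_in J) (X J)" if J: "J \<subseteq> V" for J
  proof (rule bij_betw_byWitness[where f' = "\<lambda>(x, k). ((x, \<lambda>v. min (k v) (K x)), \<lambda>v. k v - K x)"])
    have zero: "l v = 0" if "l \<in> pos_in J" "v \<notin> J" for l v
      using that by (auto simp: pos_in_def)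
    have D0: "k v = 0" if "k \<in> D" "v \<notin> V" for k v
      using that D(1) by (auto simp: supp_in_def)
    show "\<forall>p\<in>T J \<times> pos_in J. (\<lambda>(x, k). ((x, \<lambda>v. min (k v) (K x)), \<lambda>v. k v - K x))
        ((\<lambda>((x, k), l). (x, \<lambda>v. k v + l v)) p) = p"
    proof
      fix p assume "p \<in> T J \<times> pos_in J"
      then obtain x k l where p: "p = ((x, k), l)" and T: "(x, k) \<in> T J" and l: "l \<in> pos_in J"
        by auto
      have le: "k v \<le> K x" for v
        using T D0[of k v] by (cases "v \<in> V") (auto simp: T_def)
      have "min (k v + l v) (K x) = k v \<and> k v + l v - K x = l v" for v
        using T zero[OF l, of v] le[of v] by (cases "v \<in> J") (auto simp: T_def)
      then show "(\<lambda>(x, k). ((x, \<lambda>v. min (k v) (K x)), \<lambda>v. k v - K x))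
          ((\<lambda>((x, k), l). (x, \<lambda>v. k v + l v)) p) = p"
        by (simp add: p fun_eq_iff)
    qed
    show "\<forall>p\<in>X J. (\<lambda>((x, k), l). (x, \<lambda>v. k v + l v))
        ((\<lambda>(x, k). ((x, \<lambda>v. min (k v) (K x)), \<lambda>v. k v - K x)) p) = p"
      by (auto simp: fun_eq_iff)
    show "(\<lambda>((x, k), l). (x, \<lambda>v. k v + l v)) ` (T J \<times> pos_in J) \<subseteq> X J"
    proof (rule image_subsetI)
      fix p assume "p \<in> T J \<times> pos_in J"
      then obtain x k l where p: "p = ((x, k), l)" and T: "(x, k) \<in> T J" and l: "l \<in> pos_in J"
        by auto
      have lJ: "l \<in> supp_in J" using l by (auto simp: pos_in_def supp_in_def)
      have "K x < k v + l v \<longleftrightarrow> v \<in> J" if "v \<in> V" for v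
        using T l zero[OF l, of v] that by (cases "v \<in> J") (auto simp: T_def pos_in_def not_less)
      then have "{v \<in> V. K x < k v + l v} = J" using J by auto
      moreover have "x \<in> nonneg_vecs" using T by (auto simp: T_def)
      ultimately show "(\<lambda>((x, k), l). (x, \<lambda>v. k v + l v)) p \<in> X J"
        using extend[OF T J lJ] far[OF T J lJ] by (simp add: X_def p)
    qed
    show "(\<lambda>(x, k). ((x, \<lambda>v. min (k v) (K x)), \<lambda>v. k v - K x)) ` X J \<subseteq> T J \<times> pos_in J"
    proof (rule image_subsetI)
      fix p assume "p \<in> X J"
      then obtain x k where p: "p = (x, k)" and X: "(x, k) \<in> X J"
        by (cases p) auto
      let ?k = "\<lambda>v. min (k v) (K x)" and ?l = "\<lambda>v. k v - K x"
      have k: "k \<in> supp_in V" "k \<in> D" using X D(1) by (auto simp: X_def)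
      have supp: "?k \<in> supp_in V" "?l \<in> supp_in V"
        using k(1) by (auto simp: supp_in_def)
      have sum: "(\<lambda>v. ?k v + ?l v) = k" by auto
      have "?k \<in> D" using down[OF supp] k(2) unfolding sum by blast
      moreover have "comb V ?k - x \<notin> nonneg_vecs"
      proof
        assume "comb V ?k - x \<in> nonneg_vecs"
        then have "comb V ?k - x + comb V ?l \<in> nonneg_vecs"
          by (rule nonneg_vecs_add[OF _ nonneg])
        moreover have "comb V k = comb V ?k + comb V ?l"
          unfolding comb_add[symmetric] sum ..
        ultimately have "comb V k - x \<in> nonneg_vecs" by (simp add: algebra_simps)
        then show False using X by (simp add: X_def)
      qed
      ultimately have T: "(x, ?k) \<in> T J"
        using X by (auto simp: X_def T_def)
      have "0 < ?l v \<longleftrightarrow> v \<in> J" for v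
        using X D0[OF k(2), of v] J by (cases "v \<in> V") (auto simp: X_def)
      then have "?l \<in> pos_in J" by (simp add: pos_in_def)
      then show "(\<lambda>(x, k). ((x, \<lambda>v. min (k v) (K x)), \<lambda>v. k v - K x)) p \<in> T J \<times> pos_in J"
        using T by (simp add: p)
    qed
  qed

  have nondeg: "independent (emb ` J)" "card J \<le> rk M - 1" if ne: "T J \<noteq> {}" and J: "J \<subseteq> V" for J
  proof -
    obtain x k where T: "(x, k) \<in> T J" using ne by auto
    have fin: "finite J" using J V(1) finite_subset by blast
    have sub: "J \<subseteq> M" using J V(2) by blast
    have "inj_on (comb J) (supp_in J)"
    proof (rule inj_onI)
      fix l l' assume l: "l \<in> supp_in J" "l' \<in> supp_in J" "comb J l = comb J l'"
      have "comb V (\<lambda>v. k v + l v) = comb V (\<lambda>v. k v + l' v)"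
        using l by (simp add: comb_add comb_subset[OF V(1) J])
      moreover have "inj_on (comb V) D" using D(2) by (simp add: bij_betw_def)
      ultimately have "(\<lambda>v. k v + l v) = (\<lambda>v. k v + l' v)"
        using extend[OF T J] l(1,2) by (auto simp: inj_on_def)
      then show "l = l'" by (simp add: fun_eq_iff)
    qed
    then show ind: "independent (emb ` J)" by (rule independent_emb[OF fin])
    have "card J \<noteq> rk M"
    proof
      assume full: "card J = rk M"
      obtain i where i: "comb V k $ i < x $ i"
        using T by (auto simp: T_def nonneg_vecs_def not_le)
      obtain v where v: "v \<in> J" "v $ i \<noteq> 0"
        using basis_meets_every_coordinate[OF m0 fin sub ind full] .
      have "v \<in> nonneg_vecs"
        using v(1) J V(2) by blast
      then have "0 \<le> v $ i" by (simp add: nonneg_vecs_def)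
      then have "1 \<le> v $ i" using v(2) by linarith
      then have "int (K x) \<le> int (k v) * v $ i"
        using T v(1) mult_left_mono[of 1 "v $ i" "int (K x)"] by (simp add: T_def)
      also have "\<dots> \<le> comb V k $ i"
        unfolding comb_nth using v(1) J V(1,2)
        by (intro member_le_sum) (auto simp: nonneg_vecs_def)
      finally show False
        using i K_coord[of x i] T by (simp add: T_def)
    qed
    then show "card J \<le> rk M - 1"
      using independent_card_le_rk[OF sub ind] by linarith
  qed

  define C where "C = (\<Sum>v\<in>V. height v)"
  have C: "0 \<le> C" unfolding C_def using V(2) height_nonneg by (intro sum_nonneg) auto
  have height_comb: "height (comb V k) \<le> C * (real K0 + height x)" if "(x, k) \<in> T J" for x k J
  proof -
    have "height (comb V k) = (\<Sum>v\<in>V. real (k v) * height v)"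
      by (simp add: height_def comb_nth sum_distrib_left) (rule sum.swap)
    also have "\<dots> \<le> (\<Sum>v\<in>V. real (K x) * height v)"
      using that V(2) by (intro sum_mono mult_right_mono height_nonneg) (auto simp: T_def)
    also have "\<dots> = C * real (K x)"
      by (simp add: C_def sum_distrib_right mult.commute)
    finally show ?thesis
      using that K_height[of x] by (simp add: T_def)
  qed
  \<comment> \<open>half of the available decay of \<open>a\<close> pays for convergence beyond the tube, the other half for the
      summation over the truncated coefficients\<close>
  define \<eta> where "\<eta> = \<theta> / (2 * (C + 1))"
  have \<eta>: "0 < \<eta>" "2 * \<eta> * C \<le> \<theta>"
    using \<theta> C by (auto simp: \<eta>_def field_simps)
  have weight: "(\<lambda>(x, k). norm (a x) * real q powr (\<theta> * height x) * real q powr (- \<eta> * height (comb V k)))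
      summable_on (nonneg_vecs \<times> D)"
  proof -
    have "(\<lambda>k. real q powr (- \<eta> * height (comb V k))) summable_on D"
      using summable_on_subset_banach[OF summable_powr_height[OF q \<eta>(1)], of "M \<inter> nonneg_vecs"]
      by (subst summable_on_reindex_bij_betw[OF D(2)]) auto
    with has_sum_times(2)[of "\<lambda>x. norm (a x) * real q powr (\<theta> * height x)" nonneg_vecs
        "\<lambda>k. real q powr (- \<eta> * height (comb V k))" D] a
    show ?thesis by (simp add: norm_mult)
  qed
  have T_weight: "(\<lambda>t. norm (a (fst t)) * real q powr (\<eta> * height (comb V (snd t)))) summable_on T J" for J
  proof (rule summable_on_comparison_test)
    show "(\<lambda>t. real q powr (2 * \<eta> * C * real K0) * (case t of (x, k) \<Rightarrow>
        norm (a x) * real q powr (\<theta> * height x) * real q powr (- \<eta> * height (comb V k)))) summable_on T J"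
      using summable_on_subset_banach[OF weight, of "T J"] 
      by (intro summable_on_cmult_right) (auto simp: T_def)
    fix t assume "t \<in> T J"
    then obtain x k where t: "t = (x, k)" "(x, k) \<in> T J" by (cases t) auto
    have "\<eta> * height (comb V k) \<le> 2 * \<eta> * (C * (real K0 + height x)) - \<eta> * height (comb V k)"
      using mult_left_mono[OF height_comb[OF t(2)], of "2 * \<eta>"] \<eta>(1) by simp
    also have "\<dots> = 2 * \<eta> * C * real K0 + (2 * \<eta> * C) * height x - \<eta> * height (comb V k)"
      by (simp add: algebra_simps)
    also have "\<dots> \<le> 2 * \<eta> * C * real K0 + \<theta> * height x - \<eta> * height (comb V k)"
      using t(2) by (intro diff_right_mono add_left_mono mult_right_mono \<eta>(2) height_nonneg) (auto simp: T_def)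
    finally have "real q powr (\<eta> * height (comb V k)) \<le>
        real q powr (2 * \<eta> * C * real K0 + \<theta> * height x + - \<eta> * height (comb V k))"
      using q by (intro powr_mono) auto
    also have "\<dots> = real q powr (2 * \<eta> * C * real K0) * (real q powr (\<theta> * height x) * real q powr (- \<eta> * height (comb V k)))"
      by (simp only: powr_add mult.assoc)
    finally have le: "real q powr (\<eta> * height (comb V k)) \<le> real q powr (2 * \<eta> * C * real K0) *
        (real q powr (\<theta> * height x) * real q powr (- \<eta> * height (comb V k)))" .
    from mult_left_mono[OF le norm_ge_zero[of "a x"]]
    show "norm (a (fst t)) * real q powr (\<eta> * height (comb V (snd t))) \<le>
        real q powr (2 * \<eta> * C * real K0) * (case t of (x, k) \<Rightarrow>
        norm (a x) * real q powr (\<theta> * height x) * real q powr (- \<eta> * height (comb V k)))"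
      by (simp add: t(1) mult_ac)
  qed auto
  \<comment> \<open>the two factors belonging to \<open>J\<close>: truncations and excesses\<close>
  define G where "G J s = (\<Sum>\<^sub>\<infinity>t\<in>T J. a (fst t) * q_pow q s (comb V (snd t)))" for J and s :: "complex ^ 'i"
  define H where "H J s = (\<Sum>\<^sub>\<infinity>l\<in>pos_in J. q_pow q s (comb J l))" for J and s :: "complex ^ 'i"
  have G: "elem_admissible_0 q (G J)" for J
    by (rule elem_admissible_0_fibres[OF q \<eta>(1) _ T_weight]) (auto simp: G_def nonneg)
  define JJ where "JJ = {J. J \<subseteq> V \<and> T J \<noteq> {}}"
  have JJ_fin: "finite JJ" using V(1) by (simp add: JJ_def)
  have elem: "elem_admissible q (rk M - 1) (\<lambda>s. G J s * H J s)" if "J \<in> JJ" for J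
    unfolding H_def using that nondeg V G finite_subset[of J V]
    by (intro elem_admissible_simplicial q) (auto simp: JJ_def)

  have series: "(\<Sum>\<^sub>\<infinity>(x, m)\<in>{(x, m). x \<in> nonneg_vecs \<and> m \<in> M \<inter> nonneg_vecs \<and> m - x \<notin> nonneg_vecs}.
      a x * q_pow q s m) = (\<Sum>J\<in>JJ. G J s * H J s)"
    if s: "s \<in> tube (Lambda_dual_gt 0)" for s
  proof -
    let ?F = "\<lambda>p. a (fst p) * q_pow q s (comb V (snd p))"
    have sa: "(\<lambda>x. norm (a x)) summable_on nonneg_vecs"
    proof (rule summable_on_comparison_test[OF a])
      fix x :: "int ^ 'i" assume "x \<in> nonneg_vecs"
      then have "1 \<le> real q powr (\<theta> * height x)"
        using q \<theta> height_nonneg[of x] by (intro ge_one_powr_ge_zero) auto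
      then show "norm (a x) \<le> norm (a x) * real q powr (\<theta> * height x)"
        using mult_left_mono[of 1 _ "norm (a x)"] by simp
    qed simp
    have sD: "(\<lambda>k. norm (q_pow q s (comb V k))) summable_on D"
      using summable_on_subset_banach[OF summable_on_q_pow[OF q s], of "M \<inter> nonneg_vecs"]
      by (subst summable_on_reindex_bij_betw[OF D(2), of "\<lambda>y. norm (q_pow q s y)"]) auto
    have sF: "(\<lambda>p. norm (?F p)) summable_on (nonneg_vecs \<times> D)"
      using has_sum_times(2)[OF sa sD] by (simp add: case_prod_unfold)
    have sX: "?F summable_on X J" for J
      by (rule abs_summable_summable, rule summable_on_subset_banach[OF sF]) (auto simp: X_def)
    have sT: "(\<lambda>t. norm (?F t)) summable_on T J" for J
      by (rule summable_on_subset_banach[OF sF]) (auto simp: T_def)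
    have bij': "bij_betw (\<lambda>(x, k). (x, comb V k)) {(x, k). x \<in> nonneg_vecs \<and> k \<in> D \<and> comb V k - x \<notin> nonneg_vecs}
       {(x, m). x \<in> nonneg_vecs \<and> m \<in> M \<inter> nonneg_vecs \<and> m - x \<notin> nonneg_vecs}"
      by (rule bij_betw_byWitness[where f' = "\<lambda>(x, m). (x, inv_into D (comb V) m)"])
         (use bij_betw_inv_into_left[OF D(2)] bij_betw_inv_into_right[OF D(2)] bij_betwE[OF D(2)]
           bij_betwE[OF bij_betw_inv_into[OF D(2)]] in auto)
    have "(\<Sum>\<^sub>\<infinity>(x, m)\<in>{(x, m). x \<in> nonneg_vecs \<and> m \<in> M \<inter> nonneg_vecs \<and> m - x \<notin> nonneg_vecs}.
        a x * q_pow q s m) = infsum ?F {(x, k). x \<in> nonneg_vecs \<and> k \<in> D \<and> comb V k - x \<notin> nonneg_vecs}"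
      using infsum_reindex_bij_betw[OF bij', of "\<lambda>(x, m). a x * q_pow q s m"]
      by (simp add: case_prod_unfold)
    also have "{(x, k). x \<in> nonneg_vecs \<and> k \<in> D \<and> comb V k - x \<notin> nonneg_vecs} = (\<Union>J\<in>Pow V. X J)"
    proof (intro equalityI subsetI)
      fix p assume "p \<in> {(x, k). x \<in> nonneg_vecs \<and> k \<in> D \<and> comb V k - x \<notin> nonneg_vecs}"
      then obtain x k where "p = (x, k)" "x \<in> nonneg_vecs" "k \<in> D" "comb V k - x \<notin> nonneg_vecs"
        by blast
      then have "p \<in> X {v \<in> V. K x < k v}" by (simp add: X_def)
      then show "p \<in> (\<Union>J\<in>Pow V. X J)"
        by (rule UN_I[rotated]) simp
    next
      fix p assume "p \<in> (\<Union>J\<in>Pow V. X J)"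
      then obtain J where "p \<in> X J" by blast
      then show "p \<in> {(x, k). x \<in> nonneg_vecs \<and> k \<in> D \<and> comb V k - x \<notin> nonneg_vecs}"
        by (cases p) (simp add: X_def)
    qed
    also have "infsum ?F (\<Union>J\<in>Pow V. X J) = (\<Sum>J\<in>Pow V. infsum ?F (X J))"
    proof (rule sum_infsum[symmetric])
      show "finite (Pow V)" using V(1) by simp
      show "X J \<inter> X J' = {}" if "J \<noteq> J'" for J J'
        using that by (auto simp: X_def)
    qed (rule sX)
    also have "\<dots> = (\<Sum>J\<in>Pow V. if T J = {} then 0 else G J s * H J s)"
    proof (intro sum.cong refl)
      fix J assume "J \<in> Pow V"
      then have J: "J \<subseteq> V" by simp
      have "infsum ?F (X J) = (\<Sum>\<^sub>\<infinity>((x, k), l)\<in>T J \<times> pos_in J. ?F (x, \<lambda>v. k v + l v))"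
        using infsum_reindex_bij_betw[OF bij[OF J], of ?F] by (simp add: case_prod_unfold)
      also have "\<dots> = (\<Sum>\<^sub>\<infinity>(t, l)\<in>T J \<times> pos_in J. ?F t * q_pow q s (comb J l))"
      proof (intro infsum_cong)
        fix p assume "p \<in> T J \<times> pos_in J"
        then obtain x k l where p: "p = ((x, k), l)" and "l \<in> pos_in J"
          by auto
        then have "comb V l = comb J l"
          by (intro comb_subset[OF V(1) J]) (auto simp: pos_in_def supp_in_def)
        then show "(\<lambda>((x, k), l). ?F (x, \<lambda>v. k v + l v)) p =
            (\<lambda>(t, l). ?F t * q_pow q s (comb J l)) p"
          by (simp add: p comb_add q_pow_add)
      qed
      finally have eq: "infsum ?F (X J) = (\<Sum>\<^sub>\<infinity>(t, l)\<in>T J \<times> pos_in J. ?F t * q_pow q s (comb J l))" .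
      show "infsum ?F (X J) = (if T J = {} then 0 else G J s * H J s)"
      proof (cases "T J = {}")
        case True
        then show ?thesis by (simp add: eq)
      next
        case False
        have "finite J" "J \<subseteq> nonneg_vecs" using finite_subset[OF J V(1)] J V(2) by auto
        then have sH: "(\<lambda>l. norm (q_pow q s (comb J l))) summable_on pos_in J"
          using nondeg(1)[OF False J] by (intro summable_simplicial_series q s) auto
        show ?thesis
          using infsumI[OF has_sum_times(1)[OF sT sH]] False by (simp add: eq G_def H_def)
      qed
    qed
    also have "\<dots> = (\<Sum>J\<in>JJ. G J s * H J s)"
      using V(1) by (intro sum.mono_neutral_cong_right) (auto simp: JJ_def)
    finally show ?thesis .
  qed
  obtain e where e: "bij_betw e {..<card JJ} JJ"
    using ex_bij_betw_nat_finite[OF JJ_fin] by (metis lessThan_atLeast0)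
  show ?thesis
    unfolding admissible_def
  proof (intro conjI exI[of _ "card JJ"] exI[of _ "\<lambda>n s. G (e n) s * H (e n) s"] allI impI ballI)
    show "1 - int (rk M) \<le> 0"
      using rk_pos[OF m0] by simp
    have "nat (- (1 - int (rk M))) = rk M - 1" by simp
    then show "elem_admissible q (nat (- (1 - int (rk M)))) (\<lambda>s. G (e n) s * H (e n) s)"
      if "n < card JJ" for n
      using elem[of "e n"] e that by (auto simp: bij_betw_def)
    show "(\<Sum>\<^sub>\<infinity>(x, m)\<in>{(x, m). x \<in> nonneg_vecs \<and> m \<in> M \<inter> nonneg_vecs \<and> m - x \<notin> nonneg_vecs}.
      a x * q_pow q s m) = (\<Sum>n<card JJ. G (e n) s * H (e n) s)"
      if "s \<in> tube (Lambda_dual_gt 0)" for s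
      using series[OF that] sum.reindex_bij_betw[OF e, of "\<lambda>J. G J s * H J s"] by simp
  qed
qed

lemma card_field_gt_1:
  fixes K :: "('k, 'm) ring_scheme"
  assumes "field K" "finite (carrier K)"
  shows "1 < card (carrier K)"
proof -
  interpret field K by fact
  have "card {\<zero>\<^bsub>K\<^esub>, \<one>\<^bsub>K\<^esub>} \<le> card (carrier K)"
    using assms(2) by (intro card_mono) auto
  then show ?thesis using zero_not_one by simp
qed

theorem mainTheorem2:
  fixes K :: "('k, 'm) ring_scheme"
    and q :: nat
    and M :: "(int ^ 'i) set"
    and a :: "int ^ 'i \<Rightarrow> complex"
    and \<epsilon> :: real
    and \<mu> :: "((int ^ 'i) set \<Rightarrow> complex) measure"
  assumes "field K" and "finite (carrier K)" and "q = card (carrier K)"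
    and "subgroup M lattice_group"
    and "torsion_free (lattice_group Mod M)"
    and "haar_prob (lattice_group Mod M) \<mu>"
    and "\<epsilon> > 0"
    and "\<And>s. s \<in> tube (Lambda_dual_gt (- \<epsilon>)) \<Longrightarrow> L_conv UNIV Lambda a (q_pow q s)"
    and "Gamma_dual M \<inter> dual_cone Lambda = {0}"
  shows "admissible q (1 - int (rk M))
           (\<lambda>s. f1 q M \<mu> a s -
                L_fun UNIV Lambda a (\<lambda>_. 1) *
                L_fun UNIV (Lambda \<inter> real_span M) (\<lambda>_. 1) (q_pow q s))"
proof -
  let ?N = "nonneg_vecs :: (int ^ 'i) set"
  define far where "far = {(x, m). x \<in> ?N \<and> m \<in> M \<inter> ?N \<and> m - x \<notin> ?N}"
  have q: "1 < q" using card_field_gt_1[OF assms(1,2)] assms(3) by simp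
  obtain m0 where m0: "m0 \<in> M" "\<And>i. 0 < m0 $ i"
    using positive_element[OF assms(4,9)] by blast
  define \<theta> where "\<theta> = \<epsilon> / 2"
  have \<theta>: "0 < \<theta>" using assms(7) by (simp add: \<theta>_def)
  have a: "(\<lambda>x. norm (a x) * real q powr (\<theta> * height x)) summable_on ?N"
  proof -
    let ?s = "(\<chi> i. of_real (- \<theta>)) :: complex ^ 'i"
    have "?s \<in> tube (Lambda_dual_gt (- \<epsilon>))"
      using assms(7) by (simp add: tube_iff \<theta>_def)
    from assms(8)[OF this] show ?thesis
      by (simp add: L_conv_Lambda norm_mult norm_q_pow height_def sum_distrib_left mult.commute sum_negf)
  qed
  have sa: "(\<lambda>x. norm (a x)) summable_on ?N"
  proof -
    have "(0 :: complex ^ 'i) \<in> tube (Lambda_dual_gt (- \<epsilon>))"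
      using assms(7) by (simp add: tube_iff)
    from assms(8)[OF this] show ?thesis
      using q by (simp add: L_conv_Lambda q_pow_def pairing_def)
  qed
  have "admissible q (1 - int (rk M)) (\<lambda>s. \<Sum>\<^sub>\<infinity>(x, m)\<in>far. - a x * q_pow q s m)"
    unfolding far_def using a by (intro deficient_series_admissible[OF assms(4) q m0 \<theta>]) simp
  moreover have "f1 q M \<mu> a s - L_fun UNIV Lambda a (\<lambda>_. 1) *
      L_fun UNIV (Lambda \<inter> real_span M) (\<lambda>_. 1) (q_pow q s) = (\<Sum>\<^sub>\<infinity>(x, m)\<in>far. - a x * q_pow q s m)"
    if s: "s \<in> tube (Lambda_dual_gt 0)" for s
  proof -
    define near where "near = {(x, m). x \<in> ?N \<and> m \<in> M \<and> m - x \<in> ?N}"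
    let ?F = "\<lambda>(x, m). a x * q_pow q s m"
    have tube: "s \<in> tube (Lambda_dual_gt (- \<epsilon>))"
      using s assms(7) by (auto simp: tube_iff intro: less_trans[of _ 0])
    have nonneg: "m \<in> ?N" if "x \<in> ?N" "m - x \<in> ?N" for x m
      using nonneg_vecs_add[OF that] by simp
    have split: "?N \<times> (M \<inter> ?N) = near \<union> far" "near \<inter> far = {}"
      unfolding near_def far_def by (auto intro: nonneg)
    have sm: "(\<lambda>m. norm (q_pow q s m)) summable_on (M \<inter> ?N)"
      by (rule summable_on_subset_banach[OF summable_on_q_pow[OF q s]]) auto
    have sF: "?F summable_on (?N \<times> (M \<inter> ?N))"
      using has_sum_times(1)[OF sa sm] by (rule has_sum_imp_summable)
    have "{y \<in> UNIV. emb y \<in> Lambda \<inter> real_span M} = M \<inter> ?N"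
      using real_span_Int_lattice[OF assms(4,5)] by (auto simp: emb_mem_Lambda)
    then have "L_fun UNIV Lambda a (\<lambda>_. 1) * L_fun UNIV (Lambda \<inter> real_span M) (\<lambda>_. 1) (q_pow q s) =
        infsum a ?N * infsum (q_pow q s) (M \<inter> ?N)"
      by (simp add: L_fun_def emb_mem_Lambda)
    also have "\<dots> = infsum ?F (?N \<times> (M \<inter> ?N))"
      using infsumI[OF has_sum_times(1)[OF sa sm]] by simp
    also have "\<dots> = infsum ?F near + infsum ?F far"
      unfolding split(1) using sF split
      by (intro infsum_Un_disjoint) (auto intro: summable_on_subset_banach)
    also have "infsum ?F near = f1 q M \<mu> a s"
      using f1_eq_sum[OF assms(4,6,5) q s assms(8)[OF tube]] by (simp add: near_def)
    finally show ?thesis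
      by (simp add: infsum_uminus case_prod_unfold)
  qed
  ultimately show ?thesis
    unfolding admissible_def by simp
qed

end
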